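(* There is an algorithm (called OptPrice), running in time $O(n^2\log n)$, which takes as input the budget $B$, the valuation coefficients $v_1,\ldots,v_n$, the production costs $c_1,\ldots,c_n$ and any $\epsilon>0$, and outputs a price vector $\hat p$ such that the consumer's choice is uniquely specified by $\hat p$, i.e. $X(u,\hat p,B)=\{\hat x\}$ is a singleton, and $\hat x\cdot(\hat p-c)\ge \mathrm{OPT}-\epsilon$.
   Context: There are $n$ divisible goods. A bundle is a vector $x\in[0,1]^n$ and a price vector is $p\in[0,1]^n$ (prices are normalized to be at most $1$). A consumer has a budget $B\ge 0$ and a linear utility function $u(x)=x\cdot v$, where the valuation coefficients are discretized and lower-bounded: each $v_i\in\{\delta,2\delta,\ldots,1\}$ for a discretization parameter $\delta>0$. Facing prices $p$, the consumer buys a bundle in $X(u,p,B)=\arg\max_{x\in[0,1]^n,\ x\cdot p\le B}u(x)$; the consumer's choice is "uniquely specified" by $p$ if this set is a singleton. The merchant has production cost $c_i\le 1$ for each good $i$, and earns profit $x\cdot(p-c)$ when the consumer buys $x$ at prices $p$. The optimal profit is $\mathrm{OPT}=\max_{p\in[0,1]^n}\max_{x\in X(u,p,B)}x\cdot(p-c)$. *)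

theory Defs
  imports "Jordan_Normal_Form.Matrix" "HOL-Library.Landau_Symbols"
begin

section \<open>The pricing problem\<close>

text \<open>
  Bundles, prices, valuations and costs for \<^term>\<open>n\<close> goods are vectors in
  \<^term>\<open>carrier_vec n :: real vec set\<close>, so that \<^term>\<open>n\<close> can be quantified over;
  \<open>\<bullet>\<close> is the scalar product.
\<close>

definition unit_cube :: "nat \<Rightarrow> real vec set" where
  "unit_cube n = {x \<in> carrier_vec n. \<forall>i<n. 0 \<le> x $ i \<and> x $ i \<le> 1}"

definition valuation_grid :: "real \<Rightarrow> real set" where
  "valuation_grid \<delta> = {real k * \<delta> | k :: nat. 1 \<le> k \<and> real k * \<delta> \<le> 1}"

definition utility :: "real vec \<Rightarrow> real vec \<Rightarrow> real" where
  "utility v x = x \<bullet> v"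

definition demand :: "nat \<Rightarrow> (real vec \<Rightarrow> real) \<Rightarrow> real vec \<Rightarrow> real \<Rightarrow> real vec set" where
  "demand n u p B = {x. is_arg_max u (\<lambda>x. x \<in> unit_cube n \<and> x \<bullet> p \<le> B) x}"

definition profit :: "real vec \<Rightarrow> real vec \<Rightarrow> real vec \<Rightarrow> real" where
  "profit c p x = x \<bullet> (p - c)"

text \<open>
  The supremum below is a maximum whenever \<open>B \<ge> 0\<close> and the valuations are positive, see
  \<open>opt_profit_attained\<close> at the end of this theory.
\<close>

definition opt_profit :: "nat \<Rightarrow> (real vec \<Rightarrow> real) \<Rightarrow> real vec \<Rightarrow> real \<Rightarrow> real" where
  "opt_profit n u c B = Sup {profit c p x | p x. p \<in> unit_cube n \<and> x \<in> demand n u p B}"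


section \<open>The model of computation: a real RAM\<close>

text \<open>
  Algorithms are while-programs over two kinds of unbounded arrays, holding natural numbers
  (indices and counters) and exact real numbers. A scalar variable is cell 0 of an array.
  The only integer operations are addition and truncated subtraction, and the only
  operations on reals are the field operations and the comparison (no rounding and no
  conversion between the two sorts); the constants of a program are naturals and rationals.
  Every operation, memory access, constant and test takes one unit of time. Division by zero
  yields 0, as everywhere in HOL, which a program could equally well obtain by a test.
\<close>

type_synonym vname = string

record state =
  nats :: "vname \<Rightarrow> nat \<Rightarrow> nat"
  reals :: "vname \<Rightarrow> nat \<Rightarrow> real"

datatype nexp =
    NConst nat
  | NGet vname nexp
  | NAdd nexp nexp
  | NSub nexp nexp

datatype rexp =
    RConst rat
  | RGet vname nexp
  | RAdd rexp rexp
  | RSub rexp rexp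
  | RMul rexp rexp
  | RDiv rexp rexp

datatype bexp =
    NLess nexp nexp
  | RLess rexp rexp
  | Neg bexp
  | Conj bexp bexp

datatype com =
    Skip
  | NSet vname nexp nexp
  | RSet vname nexp rexp
  | Seq com com
  | Cond bexp com com
  | While bexp com

primrec nval :: "nexp \<Rightarrow> state \<Rightarrow> nat" where
  "nval (NConst k) s = k"
| "nval (NGet a i) s = nats s a (nval i s)"
| "nval (NAdd e1 e2) s = nval e1 s + nval e2 s"
| "nval (NSub e1 e2) s = nval e1 s - nval e2 s"

primrec rval :: "rexp \<Rightarrow> state \<Rightarrow> real" where
  "rval (RConst q) s = of_rat q"
| "rval (RGet a i) s = reals s a (nval i s)"
| "rval (RAdd e1 e2) s = rval e1 s + rval e2 s"
| "rval (RSub e1 e2) s = rval e1 s - rval e2 s"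
| "rval (RMul e1 e2) s = rval e1 s * rval e2 s"
| "rval (RDiv e1 e2) s = rval e1 s / rval e2 s"

primrec bval :: "bexp \<Rightarrow> state \<Rightarrow> bool" where
  "bval (NLess e1 e2) s = (nval e1 s < nval e2 s)"
| "bval (RLess e1 e2) s = (rval e1 s < rval e2 s)"
| "bval (Neg b) s = (\<not> bval b s)"
| "bval (Conj b1 b2) s = (bval b1 s \<and> bval b2 s)"

primrec ncost :: "nexp \<Rightarrow> nat" where
  "ncost (NConst k) = 1"
| "ncost (NGet a i) = 1 + ncost i"
| "ncost (NAdd e1 e2) = 1 + ncost e1 + ncost e2"
| "ncost (NSub e1 e2) = 1 + ncost e1 + ncost e2"

primrec rcost :: "rexp \<Rightarrow> nat" where
  "rcost (RConst q) = 1"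
| "rcost (RGet a i) = 1 + ncost i"
| "rcost (RAdd e1 e2) = 1 + rcost e1 + rcost e2"
| "rcost (RSub e1 e2) = 1 + rcost e1 + rcost e2"
| "rcost (RMul e1 e2) = 1 + rcost e1 + rcost e2"
| "rcost (RDiv e1 e2) = 1 + rcost e1 + rcost e2"

primrec bcost :: "bexp \<Rightarrow> nat" where
  "bcost (NLess e1 e2) = 1 + ncost e1 + ncost e2"
| "bcost (RLess e1 e2) = 1 + rcost e1 + rcost e2"
| "bcost (Neg b) = 1 + bcost b"
| "bcost (Conj b1 b2) = 1 + bcost b1 + bcost b2"

text \<open>\<open>exec P s t s'\<close>: started in \<open>s\<close>, the program \<open>P\<close> halts in \<open>s'\<close> after \<open>t\<close> time units.\<close>

inductive exec :: "com \<Rightarrow> state \<Rightarrow> nat \<Rightarrow> state \<Rightarrow> bool" where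
  Skip: "exec Skip s 1 s"
| NSet: "exec (NSet a i e) s (1 + ncost i + ncost e)
    (s\<lparr>nats := (nats s)(a := (nats s a)(nval i s := nval e s))\<rparr>)"
| RSet: "exec (RSet a i e) s (1 + ncost i + rcost e)
    (s\<lparr>reals := (reals s)(a := (reals s a)(nval i s := rval e s))\<rparr>)"
| Seq: "exec P s t1 s1 \<Longrightarrow> exec Q s1 t2 s2 \<Longrightarrow> exec (Seq P Q) s (t1 + t2) s2"
| CondTrue: "bval b s \<Longrightarrow> exec P s t s' \<Longrightarrow> exec (Cond b P Q) s (bcost b + t) s'"
| CondFalse: "\<not> bval b s \<Longrightarrow> exec Q s t s' \<Longrightarrow> exec (Cond b P Q) s (bcost b + t) s'"
| WhileFalse: "\<not> bval b s \<Longrightarrow> exec (While b P) s (bcost b) s"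
| WhileTrue: "bval b s \<Longrightarrow> exec P s t1 s1 \<Longrightarrow> exec (While b P) s1 t2 s2 \<Longrightarrow>
    exec (While b P) s (bcost b + t1 + t2) s2"

inductive_cases exec_SkipE: "exec Skip s t s'"
inductive_cases exec_NSetE: "exec (NSet a i e) s t s'"
inductive_cases exec_RSetE: "exec (RSet a i e) s t s'"
inductive_cases exec_SeqE: "exec (Seq P Q) s t s'"
inductive_cases exec_CondE: "exec (Cond b P Q) s t s'"
inductive_cases exec_WhileE: "exec (While b P) s t s'"

lemma exec_deterministic:
  assumes "exec P s t s'" and "exec P s u s''"
  shows "t = u \<and> s' = s''"
  using assms
proof (induction arbitrary: u s'' rule: exec.induct)
  case (Skip s)
  then show ?case by (rule exec_SkipE) simp
next
  case (NSet a i e s)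
  then show ?case by (rule exec_NSetE) simp
next
  case (RSet a i e s)
  then show ?case by (rule exec_RSetE) simp
next
  case (Seq P s t1 s1 Q t2 s2)
  from Seq.prems show ?case by (rule exec_SeqE) (auto dest: Seq.IH)
next
  case (CondTrue b s P t s' Q)
  from CondTrue.prems show ?case
    by (rule exec_CondE) (use CondTrue.hyps in \<open>auto dest: CondTrue.IH\<close>)
next
  case (CondFalse b s Q t s' P)
  from CondFalse.prems show ?case
    by (rule exec_CondE) (use CondFalse.hyps in \<open>auto dest: CondFalse.IH\<close>)
next
  case (WhileFalse b s P)
  from WhileFalse.prems show ?case by (rule exec_WhileE) (use WhileFalse.hyps in auto)
next
  case (WhileTrue b s P t1 s1 t2 s2)
  from WhileTrue.prems show ?case
    by (rule exec_WhileE) (use WhileTrue.hyps in \<open>auto dest: WhileTrue.IH\<close>)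
qed


section \<open>Input and output\<close>

definition input_state :: "nat \<Rightarrow> real \<Rightarrow> real vec \<Rightarrow> real vec \<Rightarrow> real \<Rightarrow> state" where
  "input_state n B v c \<epsilon> =
    \<lparr>nats = (\<lambda>_ _. 0)(''n'' := (\<lambda>_. 0)(0 := n)),
     reals = (\<lambda>_ _. 0)
       (''B'' := (\<lambda>_. 0)(0 := B),
        ''eps'' := (\<lambda>_. 0)(0 := \<epsilon>),
        ''v'' := (\<lambda>i. if i < n then v $ i else 0),
        ''c'' := (\<lambda>i. if i < n then c $ i else 0))\<rparr>"

definition output_prices :: "nat \<Rightarrow> state \<Rightarrow> real vec" where
  "output_prices n s = vec n (reals s ''p'')"


section \<open>The optimal profit is attained\<close>

lemma unit_cube_subseq:
  fixes f :: "nat \<Rightarrow> nat \<Rightarrow> real"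
  assumes "\<And>k i. i < m \<Longrightarrow> 0 \<le> f k i \<and> f k i \<le> 1"
  shows "\<exists>r. strict_mono r \<and> (\<forall>i<m. convergent (\<lambda>k. f (r k) i))"
  using assms
proof (induction m)
  case 0
  show ?case by (rule exI[of _ id]) (simp add: strict_mono_def)
next
  case (Suc m)
  then obtain r where r: "strict_mono r" "\<forall>i<m. convergent (\<lambda>k. f (r k) i)"
    by (metis less_SucI)
  obtain q where q: "strict_mono q" "monoseq (\<lambda>k. f (r (q k)) m)"
    using seq_monosub[of "\<lambda>k. f (r k) m"] by blast
  have "Bseq (\<lambda>k. f (r (q k)) m)"
    by (rule BseqI'[of _ 1]) (use Suc.prems[of m] in auto)
  then have m: "convergent (\<lambda>k. f (r (q k)) m)"
    using q(2) by (rule Bseq_monoseq_convergent)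
  have "convergent (\<lambda>k. f (r (q k)) i)" if "i < Suc m" for i
  proof (cases "i = m")
    case False
    with that r(2) have "convergent (\<lambda>k. f (r k) i)" by simp
    from convergent_subseq_convergent[OF this q(1)] show ?thesis by (simp add: o_def)
  qed (use m in simp)
  then show ?case
    using strict_mono_o[OF r(1) q(1)] by (intro exI[of _ "r \<circ> q"]) (simp add: o_def)
qed

lemma scalar_prod_sum:
  assumes "w \<in> carrier_vec n"
  shows "x \<bullet> w = (\<Sum>i<n. x $ i * w $ i)"
  using assms by (auto simp: scalar_prod_def lessThan_atLeast0)

lemma profit_sum:
  assumes "c \<in> carrier_vec n"
  shows "profit c p x = (\<Sum>i<n. x $ i * (p $ i - c $ i))"
  using assms by (auto simp: profit_def scalar_prod_def lessThan_atLeast0)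

lemma profit_le:
  assumes "c \<in> carrier_vec n" "p \<in> unit_cube n" "x \<in> unit_cube n"
  shows "profit c p x \<le> (\<Sum>i<n. 1 + \<bar>c $ i\<bar>)"
  unfolding profit_sum[OF assms(1)]
proof (rule sum_mono)
  fix i assume "i \<in> {..<n}"
  then have *: "0 \<le> x $ i" "x $ i \<le> 1" "p $ i \<le> 1"
    using assms(2,3) by (auto simp: unit_cube_def)
  have "x $ i * (p $ i - c $ i) \<le> x $ i * (1 + \<bar>c $ i\<bar>)"
    using * by (intro mult_left_mono) auto
  also have "\<dots> \<le> 1 + \<bar>c $ i\<bar>"
    using mult_right_mono[OF *(2), of "1 + \<bar>c $ i\<bar>"] by simp
  finally show "x $ i * (p $ i - c $ i) \<le> 1 + \<bar>c $ i\<bar>" .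
qed

lemma demand_iff:
  "x \<in> demand n u p B \<longleftrightarrow> x \<in> unit_cube n \<and> x \<bullet> p \<le> B \<and>
    (\<forall>y\<in>unit_cube n. y \<bullet> p \<le> B \<longrightarrow> u y \<le> u x)"
  by (auto simp: demand_def is_arg_max_linorder)

theorem opt_profit_attained:
  assumes "0 \<le> B" and v: "v \<in> carrier_vec n" "\<forall>i<n. 0 < v $ i" and c: "c \<in> carrier_vec n"
  defines "profits \<equiv> {profit c p x | p x. p \<in> unit_cube n \<and> x \<in> demand n (utility v) p B}"
  shows "opt_profit n (utility v) c B \<in> profits"
    and "\<forall>r\<in>profits. r \<le> opt_profit n (utility v) c B"
proof -
  have opt: "opt_profit n (utility v) c B = Sup profits"
    by (simp add: opt_profit_def profits_def)
  have bdd: "bdd_above profits"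
    unfolding profits_def bdd_above_def
    by (rule exI[of _ "\<Sum>i<n. 1 + \<bar>c $ i\<bar>"]) (auto simp: demand_iff intro!: profit_le c)
  then show "\<forall>r\<in>profits. r \<le> opt_profit n (utility v) c B"
    unfolding opt by (auto intro: cSup_upper)
  have "vec n (\<lambda>_. 1) \<in> demand n (utility v) (0\<^sub>v n) B"
  proof -
    have "y \<bullet> v \<le> vec n (\<lambda>_. 1) \<bullet> v" if "y \<in> unit_cube n" for y
      unfolding scalar_prod_sum[OF v(1)] using that v(2)
      by (intro sum_mono mult_right_mono) (auto simp: unit_cube_def)
    then show ?thesis
      using assms(1) by (auto simp: demand_iff utility_def unit_cube_def scalar_prod_def)
  qed
  then have ne: "profits \<noteq> {}"
    unfolding profits_def by (force simp: unit_cube_def)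
  show "opt_profit n (utility v) c B \<in> profits"
  proof (cases "B = 0")
    case True
    have "finite profits"
    proof (rule finite_subset)
      show "profits \<subseteq> (\<lambda>Z. - (\<Sum>i\<in>Z. c $ i)) ` Pow {..<n}"
      proof
        fix r assume "r \<in> profits"
        then obtain p x where p: "p \<in> unit_cube n" and x: "x \<in> demand n (utility v) p B"
          and r: "r = profit c p x"
          by (auto simp: profits_def)
        have pc: "p \<in> carrier_vec n" using p by (simp add: unit_cube_def)
        have xc: "x \<in> unit_cube n" using x by (simp add: demand_iff)
        define Z where "Z = {i. i < n \<and> p $ i = 0}"
        have nn: "0 \<le> x $ i * p $ i" if "i < n" for i
          using that p xc by (auto simp: unit_cube_def)
        have "(\<Sum>i<n. x $ i * p $ i) \<le> 0"
          using x True by (simp add: demand_iff scalar_prod_sum[OF pc])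
        then have "(\<Sum>i<n. x $ i * p $ i) = 0"
          using nn by (intro antisym sum_nonneg) auto
        then have xp: "x $ i * p $ i = 0" if "i < n" for i
          using nn that by (subst (asm) sum_nonneg_eq_0_iff) auto
        define y where "y = vec n (\<lambda>i. if p $ i = 0 then 1 else (0::real))"
        have "y \<in> unit_cube n" by (auto simp: y_def unit_cube_def)
        moreover have "y \<bullet> p \<le> B"
          using True by (auto simp: scalar_prod_sum[OF pc] y_def intro!: sum_nonpos)
        ultimately have "y \<bullet> v \<le> x \<bullet> v"
          using x by (auto simp: demand_iff utility_def)
        then have le: "(\<Sum>i<n. (y $ i - x $ i) * v $ i) \<le> 0"
          by (simp add: scalar_prod_sum[OF v(1)] left_diff_distrib sum_subtractf)
        have yx: "x $ i \<le> y $ i" if "i < n" for i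
          using that xp[OF that] xc by (auto simp: y_def unit_cube_def)
        have nn2: "0 \<le> (y $ i - x $ i) * v $ i" if "i < n" for i
          using yx[OF that] v(2) that by (intro mult_nonneg_nonneg) (auto intro: less_imp_le)
        have "(\<Sum>i<n. (y $ i - x $ i) * v $ i) = 0"
          using le nn2 by (intro antisym sum_nonneg) auto
        then have "(y $ i - x $ i) * v $ i = 0" if "i < n" for i
          using nn2 that by (subst (asm) sum_nonneg_eq_0_iff) auto
        then have "x $ i = y $ i" if "i < n" for i
          using v(2) that by fastforce
        then have "r = (\<Sum>i<n. if p $ i = 0 then - c $ i else 0)"
          unfolding r profit_sum[OF c] by (intro sum.cong) (auto simp: y_def)
        also have "\<dots> = (\<Sum>i\<in>Z. - c $ i)"
          by (rule sum.mono_neutral_cong_right) (auto simp: Z_def)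
        finally show "r \<in> (\<lambda>Z. - (\<Sum>i\<in>Z. c $ i)) ` Pow {..<n}"
          by (intro image_eqI[of _ _ Z]) (auto simp: Z_def sum_negf)
      qed
    qed simp
    then show ?thesis
      unfolding opt using ne by (simp add: cSup_eq_Max)
  next
    case False
    with assms(1) have B: "0 < B" by simp
    define M where "M = Sup profits"
    have "\<exists>p x. p \<in> unit_cube n \<and> x \<in> demand n (utility v) p B \<and> M - 1 / real (Suc k) < profit c p x"
      for k
    proof -
      have "M - 1 / real (Suc k) < Sup profits" by (simp add: M_def)
      then obtain r where "r \<in> profits" "M - 1 / real (Suc k) < r"
        using less_cSupD[OF ne] by blast
      then show ?thesis by (auto simp: profits_def)
    qed
    then obtain P X where P: "\<And>k. P k \<in> unit_cube n"
      and X: "\<And>k. X k \<in> demand n (utility v) (P k) B"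
      and PX: "\<And>k. M - 1 / real (Suc k) < profit c (P k) (X k)"
      by metis
    have Xc: "X k \<in> unit_cube n" for k using X by (simp add: demand_iff)
    have "\<exists>r. strict_mono r \<and>
      (\<forall>i<n+n. convergent (\<lambda>k. if i < n then P (r k) $ i else X (r k) $ (i - n)))"
      by (rule unit_cube_subseq[of "n+n" "\<lambda>k i. if i < n then P k $ i else X k $ (i - n)"])
         (use P Xc in \<open>auto simp: unit_cube_def\<close>)
    then obtain r where r: "strict_mono r" and
      cv: "\<And>i. i < n + n \<Longrightarrow> convergent (\<lambda>k. if i < n then P (r k) $ i else X (r k) $ (i - n))"
      by blast
    define p where "p = vec n (\<lambda>i. lim (\<lambda>k. P (r k) $ i))"
    define x where "x = vec n (\<lambda>i. lim (\<lambda>k. X (r k) $ i))"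
    have Pl: "(\<lambda>k. P (r k) $ i) \<longlonglongrightarrow> p $ i" if "i < n" for i
      using cv[of i] that by (simp add: p_def convergent_LIMSEQ_iff)
    have Xl: "(\<lambda>k. X (r k) $ i) \<longlonglongrightarrow> x $ i" if "i < n" for i
      using cv[of "n + i"] that by (simp add: x_def convergent_LIMSEQ_iff)
    have p: "p \<in> unit_cube n"
      unfolding unit_cube_def
    proof (intro CollectI conjI allI impI)
      fix i assume i: "i < n"
      show "0 \<le> p $ i"
        by (rule LIMSEQ_le_const[OF Pl[OF i]]) (use P i in \<open>auto simp: unit_cube_def\<close>)
      show "p $ i \<le> 1"
        by (rule LIMSEQ_le_const2[OF Pl[OF i]]) (use P i in \<open>auto simp: unit_cube_def\<close>)
    qed (simp add: p_def)
    have x: "x \<in> unit_cube n"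
      unfolding unit_cube_def
    proof (intro CollectI conjI allI impI)
      fix i assume i: "i < n"
      show "0 \<le> x $ i"
        by (rule LIMSEQ_le_const[OF Xl[OF i]]) (use Xc i in \<open>auto simp: unit_cube_def\<close>)
      show "x $ i \<le> 1"
        by (rule LIMSEQ_le_const2[OF Xl[OF i]]) (use Xc i in \<open>auto simp: unit_cube_def\<close>)
    qed (simp add: x_def)
    have pc: "p \<in> carrier_vec n" and Pc: "\<And>k. P k \<in> carrier_vec n"
      using p P by (auto simp: unit_cube_def)
    have xp: "x \<bullet> p \<le> B"
    proof (rule LIMSEQ_le_const2)
      show "(\<lambda>k. X (r k) \<bullet> P (r k)) \<longlonglongrightarrow> x \<bullet> p"
        unfolding scalar_prod_sum[OF pc] scalar_prod_sum[OF Pc]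
        by (intro tendsto_sum tendsto_mult Pl Xl) auto
    qed (use X in \<open>auto simp: demand_iff\<close>)
    have Xv: "(\<lambda>k. X (r k) \<bullet> v) \<longlonglongrightarrow> x \<bullet> v"
      unfolding scalar_prod_sum[OF v(1)] by (intro tendsto_sum tendsto_mult tendsto_const Xl) auto
    have "y \<bullet> v \<le> x \<bullet> v" if y: "y \<in> unit_cube n" and yp: "y \<bullet> p \<le> B" for y
    proof -
      define a where "a j = 1 - 1 / real (Suc j)" for j :: nat
      have a: "0 \<le> a j" "a j < 1" for j by (auto simp: a_def field_simps)
      have yd: "dim_vec y = n" using y by (auto simp: unit_cube_def)
      have smult: "(t \<cdot>\<^sub>v y) \<bullet> w = t * (y \<bullet> w)" if "w \<in> carrier_vec n" for t w
        using that yd by (auto simp: scalar_prod_def sum_distrib_left mult.assoc)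
      have "a j * (y \<bullet> v) \<le> x \<bullet> v" for j
      proof -
        have "a j * (y \<bullet> p) < B"
          using mult_left_mono[OF yp a(1)[of j]] mult_strict_right_mono[OF a(2)[of j] B] by linarith
        moreover have "(\<lambda>k. a j * (y \<bullet> P (r k))) \<longlonglongrightarrow> a j * (y \<bullet> p)"
          unfolding scalar_prod_sum[OF pc] scalar_prod_sum[OF Pc]
          by (intro tendsto_sum tendsto_mult tendsto_const Pl) auto
        ultimately have "\<forall>\<^sub>F k in sequentially. a j * (y \<bullet> P (r k)) < B"
          using order_tendstoD(2) by blast
        moreover have "a j * (y \<bullet> v) \<le> X (r k) \<bullet> v" if "a j * (y \<bullet> P (r k)) < B" for k
        proof -
          have "a j \<cdot>\<^sub>v y \<in> unit_cube n"
            using y a[of j] by (auto simp: unit_cube_def intro!: mult_le_one)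
          moreover have "(a j \<cdot>\<^sub>v y) \<bullet> P (r k) \<le> B"
            using that by (simp add: smult[OF Pc])
          ultimately have "(a j \<cdot>\<^sub>v y) \<bullet> v \<le> X (r k) \<bullet> v"
            using X[of "r k"] unfolding demand_iff utility_def by blast
          then show ?thesis by (simp add: smult[OF v(1)])
        qed
        ultimately have "\<forall>\<^sub>F k in sequentially. a j * (y \<bullet> v) \<le> X (r k) \<bullet> v"
          by (rule eventually_mono)
        then show ?thesis
          by (intro tendsto_lowerbound[OF Xv]) auto
      qed
      moreover have "(\<lambda>j. a j * (y \<bullet> v)) \<longlonglongrightarrow> (1 - 0) * (y \<bullet> v)"
        unfolding a_def
        by (intro tendsto_mult tendsto_diff tendsto_const LIMSEQ_Suc[OF lim_1_over_n])
      ultimately show ?thesis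
        by (intro LIMSEQ_le_const2[where X = "\<lambda>j. a j * (y \<bullet> v)"]) auto
    qed
    then have xd: "x \<in> demand n (utility v) p B"
      using x xp by (auto simp: demand_iff utility_def)
    have "(\<lambda>k. profit c (P (r k)) (X (r k))) \<longlonglongrightarrow> profit c p x"
      unfolding profit_sum[OF c]
      by (intro tendsto_sum tendsto_mult tendsto_diff tendsto_const Pl Xl) auto
    moreover have "(\<lambda>k. M - 1 / real (Suc (r k))) \<longlonglongrightarrow> M - 0"
      using LIMSEQ_subseq_LIMSEQ[OF LIMSEQ_Suc[OF lim_1_over_n] r]
      by (intro tendsto_diff tendsto_const) (simp add: o_def)
    ultimately have "M - 0 \<le> profit c p x"
      using PX by (intro LIMSEQ_le) (auto intro: less_imp_le)
    moreover have mem: "profit c p x \<in> profits"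
      using p xd by (auto simp: profits_def)
    ultimately have "profit c p x = M"
      using cSup_upper[OF mem bdd] by (simp add: M_def)
    with mem show ?thesis by (simp add: opt M_def)
  qed
qed

end

theory Submission
  imports Defs
begin

text \<open>
  If the optimal prices let the consumer afford everything, the profit is at most
  \<open>min B n - (\<Sum>i<n. c\<^sub>i)\<close>. Otherwise the whole budget is spent, and maximal profit means minimal
  production cost. Let \<open>w\<close> be the largest valuation among the goods not bought completely. Goods with
  \<open>v\<^sub>i > w\<close> are bought completely, and an exchange argument against a good of valuation \<open>w\<close> shows that
  no good that is bought costs more than its cap, \<open>1\<close> if \<open>v\<^sub>i > w\<close> and \<open>v\<^sub>i / w\<close> otherwise. Goods with
  \<open>c\<^sub>i < 0\<close> may be bought completely too, as this only lowers the cost. What remains to be chosen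
  is a fractional knapsack problem over the remaining goods priced at their caps, which is solved
  greedily in the order of \<open>c\<^sub>i / v\<^sub>i\<close>. So only the \<open>n + 1\<close> candidates \<open>w \<in> {v\<^sub>0, \<dots>, v\<^sub>n\<^sub>-\<^sub>1, 0}\<close> matter
  (\<open>w = 0\<close> covers the case that everything is bought), and after sorting once each is evaluated in
  linear time.

  Lowering the prices by slightly different factors, less and less along the greedy order, makes the
  consumer follow exactly this order, so that the demand is unique. The optimality of the greedy
  choice is stable under this perturbation, by linear programming duality.
\<close>

section \<open>Total correctness with time bounds\<close>

text \<open>Time enters as an upper bound, so it can be weakened along the way. As
  \<open>exec\<close> is deterministic, one halting execution that satisfies \<open>Q\<close>
  amounts to total correctness.\<close>

definition run :: "com \<Rightarrow> state \<Rightarrow> nat \<Rightarrow> (state \<Rightarrow> bool) \<Rightarrow> bool" where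
  "run P s t Q \<longleftrightarrow> (\<exists>t' s'. exec P s t' s' \<and> t' \<le> t \<and> Q s')"

lemma runI: "exec P s t' s' \<Longrightarrow> t' \<le> t \<Longrightarrow> Q s' \<Longrightarrow> run P s t Q"
  unfolding run_def by blast

lemma run_mono:
  assumes "run P s t Q" "t \<le> u" "\<And>s'. Q s' \<Longrightarrow> R s'"
  shows "run P s u R"
  using assms unfolding run_def by (meson le_trans)

lemma run_Seq:
  assumes "run P s t Q" "\<And>s'. Q s' \<Longrightarrow> run P' s' u R" "t + u \<le> m"
  shows "run (Seq P P') s m R"
proof -
  obtain t1 s1 where 1: "exec P s t1 s1" "t1 \<le> t" "Q s1" using assms(1) by (auto simp: run_def)
  obtain t2 s2 where 2: "exec P' s1 t2 s2" "t2 \<le> u" "R s2" using assms(2)[OF 1(3)] by (auto simp: run_def)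
  have "exec (Seq P P') s (t1 + t2) s2" using 1 2 by (blast intro: exec.Seq)
  then show ?thesis by (rule runI) (use 1 2 assms(3) in auto)
qed

lemma run_Cond:
  assumes "bval b s \<Longrightarrow> run P s t R" "\<not> bval b s \<Longrightarrow> run Q s t R" "bcost b + t \<le> m"
  shows "run (Cond b P Q) s m R"
proof (cases "bval b s")
  case True
  then obtain t1 s1 where 1: "exec P s t1 s1" "t1 \<le> t" "R s1" using assms(1) by (auto simp: run_def)
  then have "exec (Cond b P Q) s (bcost b + t1) s1" using True by (blast intro: exec.CondTrue)
  then show ?thesis by (rule runI) (use 1 assms(3) in auto)
next
  case False
  then obtain t1 s1 where 1: "exec Q s t1 s1" "t1 \<le> t" "R s1" using assms(2) by (auto simp: run_def)
  then have "exec (Cond b P Q) s (bcost b + t1) s1" using False by (blast intro: exec.CondFalse)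
  then show ?thesis by (rule runI) (use 1 assms(3) in auto)
qed

section \<open>Loop-free programs and counting loops\<close>

primrec loop_free :: "com \<Rightarrow> bool" where
  "loop_free Skip = True"
| "loop_free (NSet a i e) = True"
| "loop_free (RSet a i e) = True"
| "loop_free (Seq P Q) = (loop_free P \<and> loop_free Q)"
| "loop_free (Cond b P Q) = (loop_free P \<and> loop_free Q)"
| "loop_free (While b P) = False"

text \<open>Symbolic execution by rewriting: for loop-free programs the simplifier computes the
  final state, without any derivation in \<open>exec\<close>. The value at \<open>While\<close> is a
  dummy.\<close>

primrec step :: "com \<Rightarrow> state \<Rightarrow> state" where
  "step Skip s = s"
| "step (NSet a i e) s = s\<lparr>nats := (nats s)(a := (nats s a)(nval i s := nval e s))\<rparr>"
| "step (RSet a i e) s = s\<lparr>reals := (reals s)(a := (reals s a)(nval i s := rval e s))\<rparr>"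
| "step (Seq P Q) s = step Q (step P s)"
| "step (Cond b P Q) s = (if bval b s then step P s else step Q s)"
| "step (While b P) s = s"

text \<open>A conditional is charged for both branches, which avoids maxima and loses only a
  constant.\<close>

primrec time_bound :: "com \<Rightarrow> nat" where
  "time_bound Skip = 1"
| "time_bound (NSet a i e) = 1 + ncost i + ncost e"
| "time_bound (RSet a i e) = 1 + ncost i + rcost e"
| "time_bound (Seq P Q) = time_bound P + time_bound Q"
| "time_bound (Cond b P Q) = bcost b + (time_bound P + time_bound Q)"
| "time_bound (While b P) = 0"

lemma run_loop_free:
  assumes "loop_free P" "Q (step P s)" "time_bound P \<le> t"
  shows "run P s t Q"
proof -
  have "\<exists>t'. exec P s t' (step P s) \<and> t' \<le> time_bound P"
    using assms(1)
  proof (induction P arbitrary: s)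
    case Skip
    then show ?case using exec.Skip by fastforce
  next
    case (NSet a i e)
    then show ?case using exec.NSet by fastforce
  next
    case (RSet a i e)
    then show ?case using exec.RSet by fastforce
  next
    case (Seq P1 P2)
    then obtain t1 t2 where "exec P1 s t1 (step P1 s)" "t1 \<le> time_bound P1"
      "exec P2 (step P1 s) t2 (step P2 (step P1 s))" "t2 \<le> time_bound P2"
      by (metis loop_free.simps(4))
    then show ?case by (intro exI[of _ "t1 + t2"]) (auto intro: exec.Seq)
  next
    case (Cond b P1 P2)
    then obtain t1 t2 where "exec P1 s t1 (step P1 s)" "t1 \<le> time_bound P1"
      "exec P2 s t2 (step P2 s)" "t2 \<le> time_bound P2"
      by (metis loop_free.simps(5))
    then show ?case
      by (intro exI[of _ "bcost b + (if bval b s then t1 else t2)"]) (auto intro: exec.intros)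
  qed auto
  then show ?thesis using assms unfolding run_def by (meson le_trans)
qed

definition For :: "vname \<Rightarrow> nexp \<Rightarrow> com \<Rightarrow> com" where
  "For x b P = Seq (NSet x (NConst 0) (NConst 0))
    (While (NLess (NGet x (NConst 0)) b)
      (Seq P (NSet x (NConst 0) (NAdd (NGet x (NConst 0)) (NConst 1)))))"

abbreviation set_counter :: "vname \<Rightarrow> nat \<Rightarrow> state \<Rightarrow> state" where
  "set_counter x k s \<equiv> s\<lparr>nats := (nats s)(x := (nats s x)(0 := k))\<rparr>"

text \<open>\<open>I k\<close> describes the loop head after \<open>k\<close> rounds and is
  therefore asserted of the state after the increment. A test costs \<open>3 + ncost b\<close>, an
  increment 6 and the initial assignment 3, which explains the constants in
  \<open>time\<close>.\<close>

lemma run_For: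
  assumes init: "I 0 (set_counter x 0 s)"
    and step: "\<And>k s. k < N \<Longrightarrow> I k s \<Longrightarrow> nats s x 0 = k \<Longrightarrow>
      run P s t (\<lambda>s'. nats s' x 0 = k \<and> I (Suc k) (set_counter x (Suc k) s'))"
    and bound: "\<And>k s. k \<le> N \<Longrightarrow> I k s \<Longrightarrow> nval b s = N"
    and time: "6 + ncost b + N * (9 + ncost b + t) \<le> m"
  shows "run (For x b P) s m (I N)"
proof -
  let ?W = "While (NLess (NGet x (NConst 0)) b)
      (Seq P (NSet x (NConst 0) (NAdd (NGet x (NConst 0)) (NConst 1))))"
  have loop: "run ?W s (3 + ncost b + (N - k) * (9 + ncost b + t)) (I N)"
    if "k \<le> N" "I k s" "nats s x 0 = k" for k s
    using that
  proof (induction "N - k" arbitrary: k s)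
    case 0
    then have "k = N" by simp
    then have "\<not> bval (NLess (NGet x (NConst 0)) b) s" using 0 bound[of k s] by simp
    then have "exec ?W s (bcost (NLess (NGet x (NConst 0)) b)) s" by (rule exec.WhileFalse)
    then show ?case by (rule runI) (use 0 \<open>k = N\<close> in auto)
  next
    case (Suc d)
    then have k: "k < N" by simp
    obtain t1 s1 where 1: "exec P s t1 s1" "t1 \<le> t" "nats s1 x 0 = k" "I (Suc k) (set_counter x (Suc k) s1)"
      using step[OF k Suc.prems(2,3)] by (auto simp: run_def)
    have "exec (NSet x (NConst 0) (NAdd (NGet x (NConst 0)) (NConst 1))) s1 6 (set_counter x (Suc k) s1)"
      using exec.NSet[of x "NConst 0" "NAdd (NGet x (NConst 0)) (NConst 1)" s1] 1(3) by (simp add: eval_nat_numeral)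
    from exec.Seq[OF 1(1) this]
    have e1: "exec (Seq P (NSet x (NConst 0) (NAdd (NGet x (NConst 0)) (NConst 1)))) s (t1 + 6) (set_counter x (Suc k) s1)" .
    have "run ?W (set_counter x (Suc k) s1) (3 + ncost b + (N - Suc k) * (9 + ncost b + t)) (I N)"
      using Suc.hyps(2) k 1(4) by (intro Suc.hyps(1)) auto
    then obtain t2 s2 where 2: "exec ?W (set_counter x (Suc k) s1) t2 s2"
      "t2 \<le> 3 + ncost b + (N - Suc k) * (9 + ncost b + t)" "I N s2"
      by (auto simp: run_def)
    have "bval (NLess (NGet x (NConst 0)) b) s" using k Suc.prems bound[of k s] by simp
    from exec.WhileTrue[OF this e1 2(1)]
    have e: "exec ?W s (bcost (NLess (NGet x (NConst 0)) b) + (t1 + 6) + t2) s2" .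
    have "N - k = Suc (N - Suc k)" using k by simp
    then have "bcost (NLess (NGet x (NConst 0)) b) + (t1 + 6) + t2 \<le>
        3 + ncost b + (N - k) * (9 + ncost b + t)"
      using 1(2) 2(2) by simp
    then show ?case by (rule runI[OF e]) (rule 2(3))
  qed
  have "run ?W (set_counter x 0 s) (3 + ncost b + N * (9 + ncost b + t)) (I N)"
    using loop[of 0 "set_counter x 0 s"] init by simp
  moreover have "run (NSet x (NConst 0) (NConst 0)) s 3 (\<lambda>s'. s' = set_counter x 0 s)"
    by (rule run_loop_free) auto
  ultimately show ?thesis
    unfolding For_def
    by (elim run_Seq[where u = "3 + ncost b + N * (9 + ncost b + t)"]) (use time in auto)
qed


section \<open>Near-optimal prices\<close>

text \<open>Trading a little of \<open>k\<close> for \<open>i\<close> cannot raise the utility, so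
  \<open>i\<close> yields at most as much utility per unit of money as \<open>k\<close>. Prices may
  be 0, hence no division.\<close>

lemma exchange:
  fixes X P V :: "nat \<Rightarrow> real"
  assumes opt: "\<And>Y. (\<And>i. i < n \<Longrightarrow> 0 \<le> Y i \<and> Y i \<le> 1) \<Longrightarrow> (\<Sum>i<n. Y i * P i) \<le> B \<Longrightarrow>
      (\<Sum>i<n. Y i * V i) \<le> (\<Sum>i<n. X i * V i)"
    and X: "\<And>i. i < n \<Longrightarrow> 0 \<le> X i \<and> X i \<le> 1" and XB: "(\<Sum>i<n. X i * P i) \<le> B"
    and P: "\<And>i. i < n \<Longrightarrow> 0 \<le> P i \<and> P i \<le> 1"
    and i: "i < n" "X i < 1" and k: "k < n" "0 < X k"
  shows "P k * V i \<le> P i * V k"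
proof (cases "i = k")
  case False
  define t where "t = min (1 - X i) (X k)"
  have t: "0 < t" "t \<le> 1 - X i" "t \<le> X k" using i k by (auto simp: t_def)
  \<comment> \<open>The amounts \<open>t * P k\<close> and \<open>t * P i\<close> keep the
    expenditure constant. Prices are at most 1, so both are at most \<open>t\<close> and the bundle
    stays in the cube.\<close>
  define Y where "Y = (\<lambda>j. X j + (if j = i then t * P k else 0) - (if j = k then t * P i else 0))"
  have tk: "t * P k \<le> t" "0 \<le> t * P k" "t * P i \<le> t" "0 \<le> t * P i"
    using t(1) P[OF i(1)] P[OF k(1)] by (auto simp: mult_le_cancel_left1)
  have tk': "X i + t * P k \<le> 1" "t * P i \<le> X k" using tk t by linarith+
  have Ysum: "(\<Sum>j<n. Y j * f j) = (\<Sum>j<n. X j * f j) + t * P k * f i - t * P i * f k" for f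
  proof -
    have "Y j * f j = X j * f j + (if j = i then t * P k * f j else 0) - (if j = k then t * P i * f j else 0)" for j
      by (simp add: Y_def algebra_simps)
    then show ?thesis
      using i(1) k(1) by (simp add: sum.distrib sum_subtractf sum.delta)
  qed
  have "0 \<le> Y j \<and> Y j \<le> 1" if "j < n" for j
    using X[OF that] tk(2,4) tk' False by (auto simp: Y_def)
  moreover have "(\<Sum>j<n. Y j * P j) \<le> B"
    unfolding Ysum using XB by (simp add: mult.commute mult.left_commute)
  ultimately have "(\<Sum>j<n. Y j * V j) \<le> (\<Sum>j<n. X j * V j)" by (rule opt)
  then have "t * (P k * V i) \<le> t * (P i * V k)" unfolding Ysum by (simp add: mult.assoc)
  then show ?thesis using t(1) by simp
qed simp

lemma budget_exhausted:
  fixes X P V :: "nat \<Rightarrow> real"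
  assumes opt: "\<And>Y. (\<And>i. i < n \<Longrightarrow> 0 \<le> Y i \<and> Y i \<le> 1) \<Longrightarrow> (\<Sum>i<n. Y i * P i) \<le> B \<Longrightarrow>
      (\<Sum>i<n. Y i * V i) \<le> (\<Sum>i<n. X i * V i)"
    and X: "\<And>i. i < n \<Longrightarrow> 0 \<le> X i \<and> X i \<le> 1" and XB: "(\<Sum>i<n. X i * P i) \<le> B"
    and P: "\<And>i. i < n \<Longrightarrow> 0 \<le> P i \<and> P i \<le> 1"
    and i: "i < n" "X i < 1" and V: "0 < V i"
  shows "(\<Sum>i<n. X i * P i) = B"
proof (rule ccontr)
  assume "(\<Sum>i<n. X i * P i) \<noteq> B"
  \<comment> \<open>Leftover money is spent on \<open>i\<close>: since \<open>P i \<le> 1\<close>,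
    buying \<open>t\<close> units costs at most \<open>t\<close>, hence at most what is
    left.\<close>
  define t where "t = min (1 - X i) (B - (\<Sum>i<n. X i * P i))"
  have t: "0 < t" "t \<le> 1 - X i" "t \<le> B - (\<Sum>i<n. X i * P i)"
    using i XB \<open>_ \<noteq> B\<close> by (auto simp: t_def)
  define Y where "Y = (\<lambda>j. X j + (if j = i then t else 0))"
  have Ysum: "(\<Sum>j<n. Y j * f j) = (\<Sum>j<n. X j * f j) + t * f i" for f
  proof -
    have "Y j * f j = X j * f j + (if j = i then t * f j else 0)" for j
      by (simp add: Y_def algebra_simps)
    then show ?thesis using i(1) by (simp add: sum.distrib sum.delta)
  qed
  have "0 \<le> Y j \<and> Y j \<le> 1" if "j < n" for j
    using X[OF that] t by (auto simp: Y_def)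
  moreover have "(\<Sum>j<n. Y j * P j) \<le> B"
  proof -
    have "t * P i \<le> t" using t(1) P[OF i(1)] by (auto simp: mult_le_cancel_left1)
    then show ?thesis using t(3) by (simp add: Ysum)
  qed
  ultimately have "(\<Sum>j<n. Y j * V j) \<le> (\<Sum>j<n. X j * V j)" by (rule opt)
  moreover have "0 < t * V i" using t(1) V by simp
  ultimately show False by (simp add: Ysum)
qed

section \<open>Candidate prices and the greedy bundle\<close>

locale pricing =
  fixes n :: nat and B :: real and V C :: "nat \<Rightarrow> real" and \<epsilon> :: real
  assumes B_nonneg: "0 \<le> B"
    and V_pos: "\<And>i. i < n \<Longrightarrow> 0 < V i" and V_le: "\<And>i. i < n \<Longrightarrow> V i \<le> 1"
    and V_n: "V n = 0" \<comment> \<open>arrays are zero beyond the input, so \<open>V n\<close> is the candidate \<open>w = 0\<close>\<close>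
    and C_le: "\<And>i. i < n \<Longrightarrow> C i \<le> 1" and eps_pos: "0 < \<epsilon>"
begin

text \<open>All prices are lowered by factors in \<open>[g0, 1]\<close>. Since \<open>M\<close> bounds both \<open>n\<close> and every \<open>1 / V i\<close>, the
  loss will be at most \<open>(1 - g0) * (M * (1 + M)) \<le> \<epsilon>\<close>.\<close>

definition M :: real where "M = (\<Sum>i<n. 1 / V i)"
definition eta :: real where "eta = \<epsilon> / ((1 + M) * (\<epsilon> + (1 + M) * (1 + M)))"
definition g0 :: real where "g0 = 1 - eta * (1 + M)"

text \<open>The index breaks ties, which makes this a strict total order.\<close>

definition before :: "nat \<Rightarrow> nat \<Rightarrow> bool" where
  "before k i \<longleftrightarrow> C k / V k < C i / V i \<or> C k / V k = C i / V i \<and> k < i"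

definition rank :: "nat \<Rightarrow> nat" where
  "rank i = card {k. k < n \<and> before k i}"

definition forced :: "real \<Rightarrow> nat \<Rightarrow> bool" where
  "forced w i \<longleftrightarrow> w < V i \<or> C i < 0"

text \<open>For positive \<open>w\<close> this is \<open>min 1 (V i / w)\<close>, the largest
  admissible price at which good \<open>i\<close> yields at least \<open>w\<close> utility per unit
  of money. Goods with \<open>V i \<le> w\<close> become equally attractive at their caps.\<close>

definition cap :: "real \<Rightarrow> nat \<Rightarrow> real" where
  "cap w i = (if w < V i then 1 else V i / w)"

definition forced_cap :: "real \<Rightarrow> real" where
  "forced_cap w = (\<Sum>i | i < n \<and> forced w i. cap w i)"

text \<open>Keeps the forced goods affordable when their caps together exceed the budget.\<close>

definition scale :: "real \<Rightarrow> real" where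
  "scale w = (if B < forced_cap w then B / forced_cap w else 1)"

text \<open>Forced goods are the most attractive ones, and the others become strictly less
  attractive with the rank. \<open>Suc\<close> separates rank 0 from the forced goods.\<close>

definition price :: "real \<Rightarrow> nat \<Rightarrow> real" where
  "price w i = (if forced w i then scale w * g0 * cap w i else cap w i * (g0 + eta * real (Suc (rank i))))"

definition early :: "real \<Rightarrow> nat \<Rightarrow> nat set" where
  "early w k = {i. i < n \<and> (forced w i \<or> rank i < k)}"

text \<open>Full prices are subtracted even for goods bought in part or not at all, so the value can
  be negative; an unforced good then gets nothing.\<close>

definition budget_left :: "real \<Rightarrow> nat \<Rightarrow> real" where
  "budget_left w k = B - (\<Sum>i\<in>early w k. price w i)"

definition share :: "real \<Rightarrow> nat \<Rightarrow> real" where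
  "share w i = (if forced w i then 1 else
     if budget_left w (rank i) < 0 then 0 else
     if budget_left w (rank i) < price w i then budget_left w (rank i) / price w i else 1)"

definition gain :: "real \<Rightarrow> real" where
  "gain w = (\<Sum>i<n. share w i * (price w i - C i))"

section \<open>Size of the perturbation\<close>

lemma M_ge: "i < n \<Longrightarrow> 1 / V i \<le> M"
  unfolding M_def by (rule member_le_sum) (use V_pos in \<open>auto intro: less_imp_le\<close>)

lemma n_le_M: "real n \<le> M"
proof -
  have "(\<Sum>i<n. 1) \<le> M"
    unfolding M_def by (rule sum_mono) (use V_pos V_le in auto)
  then show ?thesis by simp
qed

lemma M_nonneg: "0 \<le> M" using n_le_M by simp

lemma eta_pos: "0 < eta"
  unfolding eta_def using M_nonneg eps_pos by (intro divide_pos_pos mult_pos_pos add_pos_nonneg) auto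

lemma eta_M: "eta * (1 + M) = \<epsilon> / (\<epsilon> + (1 + M) * (1 + M))"
  unfolding eta_def using M_nonneg by simp

text \<open>By \<open>eta_M\<close>, \<open>1 - g0\<close> is
  \<open>\<epsilon> / (\<epsilon> + (1 + M) * (1 + M))\<close>; the summand \<epsilon> in the
  denominator keeps it below 1 however large \<epsilon> is.\<close>

lemma g0_pos: "0 < g0" and g0_less: "g0 < 1"
proof -
  have "0 < \<epsilon> + (1 + M) * (1 + M)" "\<epsilon> < \<epsilon> + (1 + M) * (1 + M)"
    using eps_pos M_nonneg by (auto intro!: add_pos_nonneg mult_pos_pos)
  then show "0 < g0" by (simp add: g0_def eta_M)
  show "g0 < 1" using eta_pos M_nonneg by (simp add: g0_def)
qed

lemma total_loss: "(1 - g0) * (M * (1 + M)) \<le> \<epsilon>"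
proof -
  have p: "0 < \<epsilon> + (1 + M) * (1 + M)"
    using eps_pos M_nonneg by (auto intro!: add_pos_nonneg)
  have "\<epsilon> * (M * (1 + M)) \<le> \<epsilon> * (\<epsilon> + (1 + M) * (1 + M))"
    using eps_pos M_nonneg by (intro mult_left_mono) (auto simp: algebra_simps)
  then show ?thesis using p by (simp add: g0_def eta_M pos_divide_le_eq)
qed

section \<open>The greedy order as a permutation\<close>

text \<open>\<open>before\<close> is transitive, so the predecessors of \<open>k\<close> precede
  \<open>i\<close> as well, and \<open>k\<close> itself makes the inclusion strict.\<close>

lemma rank_less:
  assumes "before k i" "k < n"
  shows "rank k < rank i"
  unfolding rank_def
proof (rule psubset_card_mono)
  show "{j. j < n \<and> before j k} \<subset> {j. j < n \<and> before j i}"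
    using assms by (auto simp: before_def)
qed simp

lemma before_total: "k \<noteq> i \<Longrightarrow> before k i \<or> before i k"
  by (auto simp: before_def)

lemma rank_less_iff: "k < n \<Longrightarrow> i < n \<Longrightarrow> rank k < rank i \<longleftrightarrow> before k i"
  using rank_less[of k i] rank_less[of i k] before_total[of k i] by (cases "k = i") (auto simp: before_def)

lemma rank_inj: "inj_on rank {..<n}"
  by (rule inj_onI) (metis before_total lessThan_iff less_irrefl rank_less)

lemma rank_bound: "i < n \<Longrightarrow> rank i < n"
proof -
  assume "i < n"
  have "{k. k < n \<and> before k i} \<subset> {..<n}"
    using \<open>i < n\<close> by (auto simp: before_def)
  then show ?thesis unfolding rank_def by (metis card_lessThan finite_lessThan psubset_card_mono)
qed

lemma rank_surj:
  assumes "k < n"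
  obtains i where "i < n" "rank i = k"
proof -
  have "rank ` {..<n} = {..<n}"
    by (rule endo_inj_surj[OF _ _ rank_inj]) (auto simp: rank_bound)
  then show ?thesis using that assms by (metis imageE lessThan_iff)
qed

section \<open>Prices and expenditure for a fixed candidate\<close>

context
  fixes w :: real
  assumes w: "w = 0 \<or> (\<exists>j<n. w = V j)"
begin

lemma w_nonneg: "0 \<le> w" and w_le: "w \<le> 1"
  using w V_pos V_le by (auto intro: less_imp_le)

lemma w_pos: "i < n \<Longrightarrow> \<not> forced w i \<Longrightarrow> 0 < w"
  using V_pos[of i] by (auto simp: forced_def)

lemma cap_pos: "i < n \<Longrightarrow> 0 < cap w i"
  using V_pos[of i] by (auto simp: cap_def)

lemma cap_le: "i < n \<Longrightarrow> cap w i \<le> 1"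
  using w_nonneg V_pos[of i] by (auto simp: cap_def)

lemma cap_rest: "i < n \<Longrightarrow> \<not> forced w i \<Longrightarrow> w * cap w i = V i"
  using w_pos[of i] by (auto simp: cap_def forced_def)

lemma cap_w: "i < n \<Longrightarrow> w * cap w i \<le> V i"
  using V_pos[of i] by (auto simp: cap_def)

lemma forced_cap_nonneg: "0 \<le> forced_cap w"
  unfolding forced_cap_def by (rule sum_nonneg) (auto intro: less_imp_le cap_pos)

lemma scale_nonneg: "0 \<le> scale w" and scale_le: "scale w \<le> 1"
  using B_nonneg forced_cap_nonneg by (auto simp: scale_def)

lemma scale_cap: "scale w * forced_cap w = min B (forced_cap w)"
  using B_nonneg by (auto simp: scale_def)

text \<open>\<open>rank i + 1 \<le> n \<le> 1 + M\<close>, and \<open>g0 + eta * (1 + M)\<close> is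
  1 by definition.\<close>

lemma g_bounds:
  assumes "i < n"
  shows "g0 < g0 + eta * real (Suc (rank i))" "g0 + eta * real (Suc (rank i)) \<le> 1"
proof -
  show "g0 < g0 + eta * real (Suc (rank i))" using eta_pos by simp
  have "real (Suc (rank i)) \<le> real n"
    using rank_bound[OF assms] by (intro of_nat_mono) simp
  then have "real (Suc (rank i)) \<le> 1 + M" using n_le_M by linarith
  then have "eta * real (Suc (rank i)) \<le> eta * (1 + M)" using eta_pos by (intro mult_left_mono) auto
  then show "g0 + eta * real (Suc (rank i)) \<le> 1" by (simp add: g0_def)
qed

lemma price_nonneg: "i < n \<Longrightarrow> 0 \<le> price w i"
  using cap_pos[of i] scale_nonneg g0_pos eta_pos by (auto simp: price_def)

lemma price_rest_pos: "i < n \<Longrightarrow> \<not> forced w i \<Longrightarrow> 0 < price w i"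
  using cap_pos[of i] g_bounds(1)[of i] g0_pos by (auto simp: price_def)

lemma price_le_cap:
  assumes "i < n"
  shows "price w i \<le> cap w i"
proof -
  have "scale w * g0 \<le> 1"
    using scale_le scale_nonneg g0_less g0_pos by (intro mult_le_one) auto
  then have "scale w * g0 * cap w i \<le> 1 * cap w i"
    using cap_pos[OF assms] by (intro mult_right_mono) auto
  moreover have "cap w i * (g0 + eta * real (Suc (rank i))) \<le> cap w i * 1"
    using cap_pos[OF assms] g_bounds(2)[OF assms] by (intro mult_left_mono) auto
  ultimately show ?thesis by (simp add: price_def)
qed

lemma forced_price_sum: "(\<Sum>i | i < n \<and> forced w i. price w i) = g0 * min B (forced_cap w)"
proof -
  have "(\<Sum>i | i < n \<and> forced w i. price w i) = (\<Sum>i | i < n \<and> forced w i. scale w * g0 * cap w i)"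
    by (rule sum.cong) (auto simp: price_def)
  also have "\<dots> = g0 * (scale w * forced_cap w)"
    by (simp add: forced_cap_def sum_distrib_left mult.assoc mult.left_commute)
  finally show ?thesis by (simp add: scale_cap)
qed

lemma early_0: "early w 0 = {i. i < n \<and> forced w i}"
  by (auto simp: early_def)

lemma finite_early [simp]: "finite (early w k)"
  by (simp add: early_def)

lemma early_Suc:
  assumes "i < n" "rank i = k"
  shows "early w (Suc k) = insert i (early w k)"
    and "i \<in> early w k \<longleftrightarrow> forced w i"
  using assms rank_inj by (auto simp: early_def less_Suc_eq inj_on_def)

lemma early_n: "early w n = {..<n}"
  by (auto simp: early_def rank_bound)

lemma share_bounds: "i < n \<Longrightarrow> 0 \<le> share w i \<and> share w i \<le> 1"
  using price_rest_pos[of i] by (auto simp: share_def)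

text \<open>Induction along the greedy order: a good fits completely, or uses up the rest of the
  budget, or finds nothing left. In the last two cases both sides equal \<open>B\<close>.\<close>

lemma spent_early:
  "k \<le> n \<Longrightarrow> (\<Sum>i\<in>early w k. share w i * price w i) = min B (\<Sum>i\<in>early w k. price w i)"
proof (induction k)
  case 0
  have "(\<Sum>i\<in>early w 0. share w i * price w i) = (\<Sum>i\<in>early w 0. price w i)"
    by (rule sum.cong) (auto simp: early_0 share_def)
  \<comment> \<open>The forced goods alone never exceed the budget, because of
    \<open>scale\<close>.\<close>
  moreover have "g0 * min B (forced_cap w) \<le> 1 * B"
    using g0_pos g0_less B_nonneg forced_cap_nonneg by (intro mult_mono) auto
  ultimately show ?case by (simp add: early_0 forced_price_sum)
next
  case (Suc k)
  then obtain i where i: "i < n" "rank i = k" using rank_surj by (metis Suc_le_lessD)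
  note IH = Suc.IH[OF Suc_leD[OF Suc.prems]]
  show ?case
  proof (cases "forced w i")
    case True
    then have "early w (Suc k) = early w k" using early_Suc[OF i] by auto
    then show ?thesis using IH by simp
  next
    case False
    then have "i \<notin> early w k" using early_Suc[OF i] by simp
    then have s: "(\<Sum>i\<in>early w (Suc k). f i) = f i + (\<Sum>i\<in>early w k. f i)" for f :: "nat \<Rightarrow> real"
      by (simp add: early_Suc(1)[OF i])
    have "0 < price w i" using price_rest_pos[OF i(1) False] .
    then show ?thesis
      unfolding s IH using False i(2) by (auto simp: share_def budget_left_def min_def)
  qed
qed

lemma spent: "(\<Sum>i<n. share w i * price w i) = min B (\<Sum>i<n. price w i)"
  using spent_early[of n] by (simp add: early_n)

text \<open>If \<open>k\<close> still finds money, then the budget left after \<open>i\<close> was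
  positive, so \<open>i\<close> was paid in full.\<close>

lemma share_order:
  assumes i: "i < n" "\<not> forced w i" and k: "k < n" "\<not> forced w k"
    and r: "rank i < rank k" and k0: "0 < share w k"
  shows "share w i = 1"
proof -
  have "0 < budget_left w (rank k)"
    using k0 k(2) price_rest_pos[OF k] by (auto simp: share_def zero_less_divide_iff split: if_splits)
  moreover have "budget_left w (rank k) \<le> budget_left w (Suc (rank i))"
    unfolding budget_left_def using r price_nonneg
    by (intro diff_left_mono sum_mono2) (auto simp: early_def)
  moreover have "budget_left w (Suc (rank i)) = budget_left w (rank i) - price w i"
    using i early_Suc[OF i(1) refl] by (simp add: budget_left_def)
  ultimately show ?thesis using price_nonneg[OF i(1)] by (auto simp: share_def)
qed

text \<open>The critical good of the fractional knapsack: the first one in the greedy order that is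
  not bought completely.\<close>

lemma obtain_marginal:
  assumes "\<exists>i<n. share w i \<noteq> 1"
  obtains k where "k < n" "\<not> forced w k" "share w k < 1"
    "\<And>i. i < n \<Longrightarrow> \<not> forced w i \<Longrightarrow> rank i < rank k \<Longrightarrow> share w i = 1"
    "\<And>i. i < n \<Longrightarrow> \<not> forced w i \<Longrightarrow> rank k < rank i \<Longrightarrow> share w i = 0"
proof -
  define k where "k = (ARG_MIN rank i. i < n \<and> share w i \<noteq> 1)"
  have k: "k < n" "share w k \<noteq> 1" and le: "\<And>i. i < n \<Longrightarrow> share w i \<noteq> 1 \<Longrightarrow> rank k \<le> rank i"
    using arg_min_natI[of "\<lambda>i. i < n \<and> share w i \<noteq> 1" _ rank]
      arg_min_nat_le[of "\<lambda>i. i < n \<and> share w i \<noteq> 1" _ rank] assms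
    unfolding k_def by blast+
  have kf: "\<not> forced w k" using k(2) by (auto simp: share_def)
  show thesis
  proof
    show "share w k < 1" using share_bounds[OF k(1)] k(2) by simp
    show "share w i = 1" if "i < n" "rank i < rank k" for i using le that by force
    show "share w i = 0" if i: "i < n" "\<not> forced w i" "rank k < rank i" for i
      using share_order[OF k(1) kf i] share_bounds[OF i(1)] k(2) by fastforce
  qed (use k kf in auto)
qed

lemma share_all_or_spent: "(\<forall>i<n. share w i = 1) \<or> (\<Sum>i<n. share w i * price w i) = B"
proof (rule disjCI)
  assume "(\<Sum>i<n. share w i * price w i) \<noteq> B"
  then have lt: "(\<Sum>i<n. price w i) < B" by (auto simp: spent min_def split: if_splits)
  show "\<forall>i<n. share w i = 1"
  proof (intro allI impI)
    fix i assume i: "i < n"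
    show "share w i = 1"
    proof (cases "forced w i")
      case False
      have "(\<Sum>i\<in>early w (Suc (rank i)). price w i) \<le> (\<Sum>i<n. price w i)"
        by (rule sum_mono2) (auto simp: early_def price_nonneg)
      then have "price w i < budget_left w (rank i)"
        using lt False early_Suc[OF i refl] by (simp add: budget_left_def)
      then show ?thesis using price_nonneg[OF i] by (simp add: share_def)
    qed (simp add: share_def)
  qed
qed

section \<open>Uniqueness of the demand\<close>

text \<open>The marginal good \<open>k\<close> prices the budget: \<open>V k / price w k\<close> is the Lagrange multiplier.\<close>

lemma share_is_optimal:
  assumes y: "\<And>i. i < n \<Longrightarrow> 0 \<le> y i \<and> y i \<le> 1" and yB: "(\<Sum>i<n. y i * price w i) \<le> B"
  shows "(\<Sum>i<n. y i * V i) \<le> (\<Sum>i<n. share w i * V i)"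
    and "(\<Sum>i<n. share w i * V i) \<le> (\<Sum>i<n. y i * V i) \<Longrightarrow> i < n \<Longrightarrow> y i = share w i"
proof -
  have "(\<Sum>i<n. y i * V i) \<le> (\<Sum>i<n. share w i * V i) \<and>
    ((\<Sum>i<n. share w i * V i) \<le> (\<Sum>i<n. y i * V i) \<longrightarrow> (\<forall>i<n. y i = share w i))"
  proof (cases "\<forall>i<n. share w i = 1")
    case True
    then have e: "(\<Sum>i<n. share w i * V i) = (\<Sum>i<n. V i)" by simp
    have le: "y i * V i \<le> V i" if "i < n" for i
      using y[OF that] V_pos[OF that] by (simp add: mult_le_cancel_right1)
    have "y i = 1" if "(\<Sum>i<n. V i) \<le> (\<Sum>i<n. y i * V i)" "i < n" for i
    proof -
      have "(\<Sum>i<n. V i - y i * V i) = 0"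
        using that(1) sum_mono[of "{..<n}" "\<lambda>i. y i * V i" V] le by (simp add: sum_subtractf)
      then have "V i - y i * V i = 0"
        using that(2) le by (subst (asm) sum_nonneg_eq_0_iff) auto
      then show ?thesis using V_pos[OF that(2)] by simp
    qed
    then show ?thesis unfolding e using True le by (auto intro: sum_mono)
  next
    case False
    then have "\<exists>i<n. share w i \<noteq> 1" by blast
    then obtain k where k: "k < n" "\<not> forced w k" "share w k < 1"
      and k1: "\<And>i. i < n \<Longrightarrow> \<not> forced w i \<Longrightarrow> rank i < rank k \<Longrightarrow> share w i = 1"
      and k0: "\<And>i. i < n \<Longrightarrow> \<not> forced w i \<Longrightarrow> rank k < rank i \<Longrightarrow> share w i = 0"
      by (rule obtain_marginal) blast
    have spentB: "(\<Sum>i<n. share w i * price w i) = B" using share_all_or_spent False by blast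
    have wpos: "0 < w" using w_pos k by blast
    define g where "g = (\<lambda>i. g0 + eta * real (Suc (rank i)))"
    have wk: "w * price w k = V k * g k"
      using cap_rest[OF k(1,2)] k(2) by (simp add: price_def g_def mult.assoc[symmetric])
    \<comment> \<open>\<open>D i\<close> is \<open>price w k\<close> times the reduced value of good
      \<open>i\<close> at this multiplier. Its sign decides whether an optimal bundle contains all
      or nothing of \<open>i\<close>.\<close>
    define D where "D = (\<lambda>i. V i * price w k - V k * price w i)"
    have wD: "w * D i = V k * (V i * g k - w * price w i)" for i
    proof -
      have "w * D i = V i * (w * price w k) - V k * (w * price w i)"
        by (simp add: D_def algebra_simps)
      then show ?thesis unfolding wk by (simp add: algebra_simps)
    qed
    \<comment> \<open>Without the perturbation this would vanish. The distinct ranks make it nonzero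
      for \<open>i \<noteq> k\<close>, which is the source of uniqueness.\<close>
    have D_rest: "w * D i = V k * V i * eta * (real (rank k) - real (rank i))" if "i < n" "\<not> forced w i" for i
    proof -
      have "w * price w i = V i * g i"
        using cap_rest[OF that] that(2) by (simp add: price_def g_def mult.assoc[symmetric])
      then show ?thesis unfolding wD g_def by (simp add: algebra_simps)
    qed
    \<comment> \<open>The factor of a forced good is at most \<open>g0\<close>, below
      \<open>g k\<close>, and \<open>w * cap w i \<le> V i\<close>.\<close>
    have D_forced: "0 < D i" if "i < n" "forced w i" for i
    proof -
      have "w * price w i = scale w * g0 * (w * cap w i)" using that(2) by (simp add: price_def)
      also have "\<dots> \<le> 1 * g0 * V i"
        using scale_le scale_nonneg g0_pos cap_w[OF that(1)] w_nonneg cap_pos[OF that(1)]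
        by (intro mult_mono) auto
      also have "\<dots> < V i * g k"
        using V_pos[OF that(1)] g_bounds(1)[OF k(1)] by (simp add: g_def)
      finally have "0 < w * D i" unfolding wD using V_pos[OF k(1)] by simp
      then show ?thesis using wpos by (simp add: zero_less_mult_iff)
    qed
    have sign: "D i * (y i - share w i) \<le> 0 \<and> (D i * (y i - share w i) = 0 \<longrightarrow> i \<noteq> k \<longrightarrow> y i = share w i)"
      if i: "i < n" for i
    proof -
      consider "forced w i" | "\<not> forced w i" "rank i < rank k" | "\<not> forced w i" "rank k < rank i" | "i = k"
        using rank_inj i k(1) by (metis inj_on_def lessThan_iff linorder_neqE_nat)
      then show ?thesis
      proof cases
        case 1
        then have "share w i = 1" by (simp add: share_def)
        then show ?thesis using D_forced[OF i 1] y[OF i] by (auto simp: mult_le_0_iff)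
      next
        case 2
        then have "0 < w * D i"
          unfolding D_rest[OF i 2(1)] using V_pos[OF i] V_pos[OF k(1)] eta_pos by simp
        then have "0 < D i" using wpos by (simp add: zero_less_mult_iff)
        then show ?thesis using k1[OF i 2] y[OF i] by (auto simp: mult_le_0_iff)
      next
        case 3
        then have "w * D i < 0"
          unfolding D_rest[OF i 3(1)] using V_pos[OF i] V_pos[OF k(1)] eta_pos
          by (intro mult_pos_neg) auto
        then have "D i < 0" using wpos by (simp add: mult_less_0_iff)
        then show ?thesis using k0[OF i 3] y[OF i] by (auto simp: mult_le_0_iff)
      next
        case 4
        then show ?thesis by (simp add: D_def)
      qed
    qed
    have pk: "0 < price w k" using price_rest_pos k by blast
    \<comment> \<open>Lagrangian identity: the utility gap splits into the reduced values and the
      budget slack of \<open>y\<close>; both parts turn out nonpositive.\<close>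
    have key: "price w k * ((\<Sum>i<n. y i * V i) - (\<Sum>i<n. share w i * V i)) =
      (\<Sum>i<n. D i * (y i - share w i)) + V k * ((\<Sum>i<n. y i * price w i) - B)"
    proof -
      have "D i * (y i - share w i) = price w k * (y i * V i) - price w k * (share w i * V i)
          - V k * (y i * price w i) + V k * (share w i * price w i)" for i
        by (simp add: D_def algebra_simps)
      then have "(\<Sum>i<n. D i * (y i - share w i)) =
          price w k * (\<Sum>i<n. y i * V i) - price w k * (\<Sum>i<n. share w i * V i)
          - V k * (\<Sum>i<n. y i * price w i) + V k * B"
        by (simp only: sum.distrib sum_subtractf sum_distrib_left[symmetric] spentB)
      then show ?thesis by (simp only: right_diff_distrib)
    qed
    have s0: "(\<Sum>i<n. D i * (y i - share w i)) \<le> 0" using sign by (intro sum_nonpos) auto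
    have s1: "V k * ((\<Sum>i<n. y i * price w i) - B) \<le> 0"
      using V_pos[OF k(1)] yB by (simp add: mult_le_0_iff)
    have "(\<Sum>i<n. y i * V i) \<le> (\<Sum>i<n. share w i * V i)"
    proof -
      have "price w k * ((\<Sum>i<n. y i * V i) - (\<Sum>i<n. share w i * V i)) \<le> 0"
        unfolding key using s0 s1 by linarith
      then show ?thesis using pk by (simp add: mult_le_0_iff)
    qed
    moreover have "y i = share w i" if ge: "(\<Sum>i<n. share w i * V i) \<le> (\<Sum>i<n. y i * V i)" and i: "i < n" for i
    proof -
      have "0 \<le> price w k * ((\<Sum>i<n. y i * V i) - (\<Sum>i<n. share w i * V i))" using pk ge by simp
      \<comment> \<open>If \<open>y\<close> is optimal too, both parts vanish. This fixes every
        coordinate except \<open>k\<close>, and the exhausted budget fixes \<open>k\<close>.\<close>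
      then have z: "(\<Sum>i<n. D i * (y i - share w i)) = 0" and z': "V k * ((\<Sum>i<n. y i * price w i) - B) = 0"
        unfolding key using s0 s1 by linarith+
      have "(\<Sum>i<n. - (D i * (y i - share w i))) = 0" using z by (simp add: sum_negf)
      then have "D i * (y i - share w i) = 0" if "i < n" for i
        using sign that by (subst (asm) sum_nonneg_eq_0_iff) auto
      then have ne: "y i = share w i" if "i < n" "i \<noteq> k" for i using sign that by blast
      have "(\<Sum>i<n. (y i - share w i) * price w i) = 0"
        using z' V_pos[OF k(1)] spentB by (simp add: left_diff_distrib sum_subtractf)
      moreover have "(\<Sum>i<n. (y i - share w i) * price w i) = (y k - share w k) * price w k"
        using k(1) ne by (subst sum.remove[of _ k]) auto
      ultimately have "y k = share w k" using pk by simp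
      with ne i show ?thesis by metis
    qed
    ultimately show ?thesis by blast
  qed
  then show "(\<Sum>i<n. y i * V i) \<le> (\<Sum>i<n. share w i * V i)"
    and "(\<Sum>i<n. share w i * V i) \<le> (\<Sum>i<n. y i * V i) \<Longrightarrow> i < n \<Longrightarrow> y i = share w i"
    by blast+
qed

section \<open>Loss of the greedy bundle against an optimal one\<close>

text \<open>\<open>l\<close> is the dual multiplier of the knapsack problem that minimises cost for
  a given utility: the cost per utility of the marginal good. Unforced goods below this ratio are
  bought completely, those above it not at all. The bound \<open>l \<le> M\<close> later converts
  surplus purchases into cost.\<close>

lemma rest_multiplier:
  assumes X: "\<And>i. i < n \<Longrightarrow> 0 \<le> X i \<and> X i \<le> 1"
  obtains l where "0 \<le> l" "l \<le> M"
    "\<And>i. i < n \<Longrightarrow> \<not> forced w i \<Longrightarrow> (C i - l * V i) * (share w i - X i) \<le> 0"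
proof (cases "\<forall>i<n. share w i = 1")
  case True
  \<comment> \<open>When everything is bought, any multiplier above all the ratios will do.\<close>
  have "C i \<le> M * V i" if "i < n" for i
  proof -
    have "1 \<le> M * V i" using M_ge[OF that] V_pos[OF that] by (simp add: pos_divide_le_eq)
    then show ?thesis using C_le[OF that] by linarith
  qed
  then show ?thesis
    using X True M_nonneg by (intro that[of M]) (auto simp: mult_le_0_iff)
next
  case False
  then have "\<exists>i<n. share w i \<noteq> 1" by blast
  then obtain k where k: "k < n" "\<not> forced w k"
    and k1: "\<And>i. i < n \<Longrightarrow> \<not> forced w i \<Longrightarrow> rank i < rank k \<Longrightarrow> share w i = 1"
    and k0: "\<And>i. i < n \<Longrightarrow> \<not> forced w i \<Longrightarrow> rank k < rank i \<Longrightarrow> share w i = 0"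
    by (rule obtain_marginal) blast
  have Ck: "0 \<le> C k" using k(2) by (simp add: forced_def)
  show ?thesis
  proof (rule that[of "C k / V k"])
    show "0 \<le> C k / V k" using Ck V_pos[OF k(1)] by simp
    have "C k / V k \<le> 1 / V k" using C_le[OF k(1)] V_pos[OF k(1)] by (intro divide_right_mono) auto
    then show "C k / V k \<le> M" using M_ge[OF k(1)] by linarith
  next
    fix i assume i: "i < n" "\<not> forced w i"
    have e: "C i - C k / V k * V i = (C i / V i - C k / V k) * V i"
      using V_pos[OF i(1)] by (simp add: algebra_simps)
    consider "C i / V i < C k / V k" | "C i / V i = C k / V k" | "C k / V k < C i / V i" by linarith
    then show "(C i - C k / V k * V i) * (share w i - X i) \<le> 0"
    proof cases
      case 1
      then have "rank i < rank k" using i k by (simp add: rank_less_iff before_def)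
      from k1[OF i this] show ?thesis
        unfolding e using 1 X[OF i(1)] V_pos[OF i(1)] by (intro mult_nonpos_nonneg) (auto simp: mult_le_0_iff)
    next
      case 3
      then have "rank k < rank i" using i k by (simp add: rank_less_iff before_def)
      from k0[OF i this] show ?thesis
        unfolding e using 3 X[OF i(1)] V_pos[OF i(1)] by (intro mult_nonneg_nonpos) (auto simp: mult_le_0_iff)
    next
      case 2
      then show ?thesis unfolding e by simp
    qed
  qed
qed

lemma price_sum_ge: "g0 * (min B (forced_cap w) + (\<Sum>i | i < n \<and> \<not> forced w i. cap w i)) \<le> (\<Sum>i<n. price w i)"
proof -
  have s: "(\<Sum>i<n. price w i) = (\<Sum>i | i < n \<and> forced w i. price w i) + (\<Sum>i | i < n \<and> \<not> forced w i. price w i)"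
    by (subst sum.union_disjoint[symmetric]) (auto intro: sum.cong)
  have "(\<Sum>i | i < n \<and> \<not> forced w i. g0 * cap w i) \<le> (\<Sum>i | i < n \<and> \<not> forced w i. price w i)"
  proof (rule sum_mono)
    fix i assume "i \<in> {i. i < n \<and> \<not> forced w i}"
    then show "g0 * cap w i \<le> price w i"
      using g_bounds(1)[of i] cap_pos[of i] by (auto simp: price_def mult.commute)
  qed
  then show ?thesis by (simp add: s forced_price_sum distrib_left sum_distrib_left)
qed

end

text \<open>\<open>X\<close> is a demanded bundle at prices \<open>P\<close>. Unless
  \<open>X\<close> contains everything, the revenue drops by at most \<open>(1 - g0) * n\<close> and
  the cost rises by at most \<open>M * (1 - g0) * n\<close>; \<open>total_loss\<close> bounds the
  sum.\<close>

lemma gain_near_optimal: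
  assumes opt: "\<And>Y. (\<And>i. i < n \<Longrightarrow> 0 \<le> Y i \<and> Y i \<le> 1) \<Longrightarrow> (\<Sum>i<n. Y i * P i) \<le> B \<Longrightarrow>
      (\<Sum>i<n. Y i * V i) \<le> (\<Sum>i<n. X i * V i)"
    and X: "\<And>i. i < n \<Longrightarrow> 0 \<le> X i \<and> X i \<le> 1" and XB: "(\<Sum>i<n. X i * P i) \<le> B"
    and P: "\<And>i. i < n \<Longrightarrow> 0 \<le> P i \<and> P i \<le> 1"
  shows "\<exists>j\<le>n. (\<Sum>i<n. X i * (P i - C i)) - \<epsilon> \<le> gain (V j)"
proof (cases "\<forall>i<n. X i = 1")
  case True
  have w: "V n = 0 \<or> (\<exists>j<n. V n = V j)" using V_n by simp
  have f: "forced (V n) i" "cap (V n) i = 1" if "i < n" for i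
    using that V_pos by (auto simp: forced_def cap_def V_n)
  have fc: "forced_cap (V n) = real n"
  proof -
    have "{i. i < n \<and> forced (V n) i} = {..<n}" using f by auto
    then show ?thesis by (simp add: forced_cap_def f)
  qed
  have "gain (V n) = (\<Sum>i<n. price (V n) i) - (\<Sum>i<n. C i)"
    by (simp add: gain_def share_def f sum_subtractf)
  moreover have "(\<Sum>i<n. price (V n) i) = g0 * min B (real n)"
  proof -
    have "{i. i < n \<and> forced (V n) i} = {..<n}" using f by auto
    then show ?thesis using forced_price_sum[OF w] by (simp add: fc)
  qed
  moreover have "(\<Sum>i<n. X i * (P i - C i)) = (\<Sum>i<n. P i) - (\<Sum>i<n. C i)"
    using True by (simp add: sum_subtractf)
  moreover have "(\<Sum>i<n. P i) \<le> min B (real n)"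
  proof -
    have "(\<Sum>i<n. P i) \<le> (\<Sum>i<n. 1)" using P by (intro sum_mono) auto
    then show ?thesis using XB True by simp
  qed
  moreover have "(1 - g0) * min B (real n) \<le> \<epsilon>"
  proof -
    have "min B (real n) \<le> M * 1" using n_le_M by simp
    also have "\<dots> \<le> M * (1 + M)" using M_nonneg by (intro mult_left_mono) auto
    finally have "(1 - g0) * min B (real n) \<le> (1 - g0) * (M * (1 + M))"
      using g0_less by (intro mult_left_mono) auto
    then show ?thesis using total_loss by linarith
  qed
  ultimately have "(\<Sum>i<n. X i * (P i - C i)) - \<epsilon> \<le> gain (V n)"
    unfolding left_diff_distrib by linarith
  then show ?thesis by blast
next
  case False
  define U where "U = {i. i < n \<and> X i < 1}"
  have U: "finite U" "U \<noteq> {}" using False X by (force simp: U_def)+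
  define w where "w = Max (V ` U)"
  obtain j where j: "j < n" "X j < 1" "w = V j"
  proof -
    have "w \<in> V ` U" unfolding w_def using U by (intro Max_in) auto
    then show ?thesis using that by (auto simp: U_def)
  qed
  have Uw: "V i \<le> w" if "i < n" "X i < 1" for i
    unfolding w_def using that U by (intro Max_ge) (auto simp: U_def)
  have w: "w = 0 \<or> (\<exists>j<n. w = V j)" using j by blast
  have wpos: "0 < w" using j V_pos by simp
  have spentB: "(\<Sum>i<n. X i * P i) = B"
    using budget_exhausted[OF opt X XB P j(1,2) V_pos[OF j(1)]] by blast
  \<comment> \<open>Exchange against \<open>j\<close>, whose valuation is \<open>w\<close> and whose
    price is at most 1, bounds the price of every bought good by its cap. The factor
    \<open>X i\<close> covers goods that are not bought.\<close>
  have Pcap: "X i * P i \<le> X i * cap w i" if i: "i < n" for i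
  proof (cases "X i = 0")
    case False
    then have "0 < X i" using X[OF i] by simp
    from exchange[OF opt X XB P j(1,2) i this] have "P i * w \<le> P j * V i" using j by simp
    also have "\<dots> \<le> 1 * V i" using P[OF j(1)] V_pos[OF i] by (intro mult_right_mono) auto
    finally have "P i \<le> cap w i"
      using P[OF i] wpos by (simp add: cap_def pos_le_divide_eq)
    then show ?thesis using X[OF i] by (intro mult_left_mono) auto
  qed simp
  have Xf: "X i = 1" if "i < n" "w < V i" for i
    using Uw[OF that(1)] X[OF that(1)] that by force
  have split: "(\<Sum>i<n. f i) = (\<Sum>i | i < n \<and> forced w i. f i) + (\<Sum>i | i < n \<and> \<not> forced w i. f i)"
    for f :: "nat \<Rightarrow> real"
    by (subst sum.union_disjoint[symmetric]) (auto intro: sum.cong)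
  let ?F = "{i. i < n \<and> forced w i}" and ?R = "{i. i < n \<and> \<not> forced w i}"
  let ?A = "\<Sum>i\<in>?R. cap w i"
  have Fle: "(\<Sum>i\<in>?F. X i * P i) \<le> forced_cap w"
    unfolding forced_cap_def
  proof (rule sum_mono)
    fix i assume "i \<in> ?F"
    then have i: "i < n" by simp
    have "X i * cap w i \<le> cap w i" using X[OF i] cap_pos[OF w i] by simp
    then show "X i * P i \<le> cap w i" using Pcap[OF i] by linarith
  qed
  have Rle: "(\<Sum>i\<in>?R. X i * P i) \<le> (\<Sum>i\<in>?R. X i * cap w i)"
    using Pcap by (intro sum_mono) auto
  have Rle': "(\<Sum>i\<in>?R. X i * cap w i) \<le> ?A"
  proof (rule sum_mono)
    fix i assume "i \<in> ?R"
    then have i: "i < n" by simp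
    show "X i * cap w i \<le> cap w i" using X[OF i] cap_pos[OF w i] by simp
  qed
  have R0: "0 \<le> (\<Sum>i\<in>?R. X i * cap w i)"
    using X by (intro sum_nonneg mult_nonneg_nonneg) (auto intro: less_imp_le cap_pos[OF w])
  \<comment> \<open>What the forced goods cannot absorb at their caps is spent in \<open>X\<close>
    on the others, whose prices are within their caps if bought.\<close>
  have RB: "max 0 (B - forced_cap w) \<le> (\<Sum>i\<in>?R. X i * cap w i)"
    using Fle Rle R0 spentB split[of "\<lambda>i. X i * P i"] by linarith
  have n_cap: "forced_cap w + ?A \<le> real n"
  proof -
    have "(\<Sum>i<n. cap w i) \<le> (\<Sum>i<n. 1)" using cap_le[OF w] by (intro sum_mono) auto
    then show ?thesis by (simp add: split forced_cap_def)
  qed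
  have Bn: "B \<le> real n"
    using Fle Rle Rle' n_cap spentB split[of "\<lambda>i. X i * P i"] by linarith
  \<comment> \<open>The prices of all goods add up to at least \<open>g0 * B\<close>, so at most
    \<open>(1 - g0) * B\<close> is lost, and \<open>B \<le> n\<close>.\<close>
  have revenue: "B - (1 - g0) * real n \<le> (\<Sum>i<n. share w i * price w i)"
  proof -
    have "B \<le> min B (forced_cap w) + ?A"
      using RB Rle' by linarith
    then have "g0 * B \<le> g0 * (min B (forced_cap w) + ?A)" using g0_pos by (intro mult_left_mono) auto
    also have "\<dots> \<le> (\<Sum>i<n. price w i)" by (rule price_sum_ge[OF w])
    finally have "g0 * B \<le> (\<Sum>i<n. price w i)" .
    moreover have "g0 * B \<le> B" using B_nonneg g0_less by (simp add: mult_left_le_one_le g0_pos less_imp_le)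
    moreover have "(1 - g0) * B \<le> (1 - g0) * real n" using Bn g0_less by (intro mult_left_mono) auto
    ultimately show ?thesis unfolding spent[OF w] by (simp add: algebra_simps)
  qed
  \<comment> \<open>Lowered prices let the consumer buy more unforced goods than in
    \<open>X\<close>. Their prices are at least \<open>g0\<close> times the caps, so the surplus,
    measured at caps, is small.\<close>
  have excess: "(\<Sum>i\<in>?R. cap w i * (share w i - X i)) \<le> (1 - g0) * real n"
  proof -
    have "(\<Sum>i\<in>?R. g0 * (cap w i * share w i)) \<le> (\<Sum>i\<in>?R. share w i * price w i)"
    proof (rule sum_mono)
      fix i assume i: "i \<in> ?R"
      then have "g0 * cap w i \<le> price w i"
        using g_bounds(1)[OF w, of i] cap_pos[OF w, of i] by (auto simp: price_def mult.commute)
      then have "(g0 * cap w i) * share w i \<le> price w i * share w i"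
        using share_bounds[OF w, of i] i by (intro mult_right_mono) auto
      then show "g0 * (cap w i * share w i) \<le> share w i * price w i" by (simp add: algebra_simps)
    qed
    moreover have "(\<Sum>i\<in>?F. share w i * price w i) = g0 * min B (forced_cap w)"
      unfolding forced_price_sum[OF w, symmetric] by (rule sum.cong) (auto simp: share_def)
    ultimately have "g0 * (\<Sum>i\<in>?R. cap w i * share w i) + g0 * min B (forced_cap w) \<le> B"
      using spent[OF w] split[of "\<lambda>i. share w i * price w i"] by (simp add: sum_distrib_left)
    \<comment> \<open>Uses
      \<open>B - min B (forced_cap w) = max 0 (B - forced_cap w)\<close>.\<close>
    then have 1: "(\<Sum>i\<in>?R. cap w i * share w i) \<le> max 0 (B - forced_cap w) +
      (1 - g0) * (min B (forced_cap w) + (\<Sum>i\<in>?R. cap w i * share w i))"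
      by (auto simp: algebra_simps min_def max_def)
    have "(\<Sum>i\<in>?R. cap w i * share w i) \<le> ?A"
    proof (rule sum_mono)
      fix i assume "i \<in> ?R"
      then have i: "i < n" by simp
      show "cap w i * share w i \<le> cap w i" using share_bounds[OF w i] cap_pos[OF w i] by simp
    qed
    then have "min B (forced_cap w) + (\<Sum>i\<in>?R. cap w i * share w i) \<le> real n" using n_cap by linarith
    then have "(1 - g0) * (min B (forced_cap w) + (\<Sum>i\<in>?R. cap w i * share w i)) \<le> (1 - g0) * real n"
      using g0_less by (intro mult_left_mono) auto
    moreover have "(\<Sum>i\<in>?R. cap w i * (share w i - X i)) =
        (\<Sum>i\<in>?R. cap w i * share w i) - (\<Sum>i\<in>?R. X i * cap w i)"
      by (simp add: right_diff_distrib sum_subtractf mult.commute)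
    ultimately show ?thesis using 1 RB by linarith
  qed
  obtain l where l: "0 \<le> l" "l \<le> M"
    and lt: "\<And>i. i < n \<Longrightarrow> \<not> forced w i \<Longrightarrow> (C i - l * V i) * (share w i - X i) \<le> 0"
    by (rule rest_multiplier[OF w, of X]) (use X in auto)
  have cost: "(\<Sum>i<n. C i * share w i) \<le> (\<Sum>i<n. C i * X i) + M * ((1 - g0) * real n)"
  proof -
    \<comment> \<open>If \<open>w < V i\<close>, both bundles contain the good completely; if
      \<open>C i < 0\<close>, buying all of it costs least.\<close>
    have F: "(\<Sum>i\<in>?F. C i * share w i) \<le> (\<Sum>i\<in>?F. C i * X i)"
    proof (rule sum_mono)
      fix i assume i: "i \<in> ?F"
      show "C i * share w i \<le> C i * X i"
      proof (cases "w < V i")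
        case False
        then have "C i < 0" using i by (auto simp: forced_def)
        then show ?thesis using i X[of i] by (auto simp: share_def)
      qed (use i Xf in \<open>auto simp: share_def\<close>)
    qed
    \<comment> \<open>The multiplier replaces the costs by \<open>l * V i = l * w * cap w i\<close>,
      so that \<open>excess\<close> applies.\<close>
    have "(\<Sum>i\<in>?R. C i * (share w i - X i)) \<le> (\<Sum>i\<in>?R. (l * w) * (cap w i * (share w i - X i)))"
    proof (rule sum_mono)
      fix i assume i: "i \<in> ?R"
      then have "V i = w * cap w i" using cap_rest[OF w] by simp
      then show "C i * (share w i - X i) \<le> (l * w) * (cap w i * (share w i - X i))"
        using lt[of i] i by (simp add: algebra_simps)
    qed
    also have "\<dots> = (l * w) * (\<Sum>i\<in>?R. cap w i * (share w i - X i))"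
      by (simp add: sum_distrib_left)
    also have "\<dots> \<le> (l * w) * ((1 - g0) * real n)"
      using excess l wpos by (intro mult_left_mono) auto
    also have "\<dots> \<le> (M * 1) * ((1 - g0) * real n)"
      using l wpos w_le[OF w] g0_less M_nonneg by (intro mult_right_mono mult_mono) auto
    finally show ?thesis
      using F split[of "\<lambda>i. C i * share w i"] split[of "\<lambda>i. C i * X i"]
      by (simp add: right_diff_distrib sum_subtractf)
  qed
  have "(1 - g0) * real n + M * ((1 - g0) * real n) \<le> \<epsilon>"
  proof -
    have "real n * (1 + M) \<le> M * (1 + M)" using n_le_M M_nonneg by (intro mult_right_mono) auto
    then have "(1 - g0) * (real n * (1 + M)) \<le> (1 - g0) * (M * (1 + M))"
      using g0_less by (intro mult_left_mono) auto
    then show ?thesis using total_loss by (simp add: algebra_simps)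
  qed
  moreover have "gain w = (\<Sum>i<n. share w i * price w i) - (\<Sum>i<n. C i * share w i)"
    by (simp add: gain_def right_diff_distrib sum_subtractf mult.commute)
  moreover have "(\<Sum>i<n. X i * (P i - C i)) = B - (\<Sum>i<n. C i * X i)"
    by (simp add: right_diff_distrib sum_subtractf mult.commute spentB[symmetric])
  ultimately have "(\<Sum>i<n. X i * (P i - C i)) - \<epsilon> \<le> gain w"
    using revenue cost by linarith
  then show ?thesis using j by (auto intro!: exI[of _ j])
qed

end


section \<open>The program\<close>

abbreviation nv :: "vname \<Rightarrow> nexp" where "nv x \<equiv> NGet x (NConst 0)"
abbreviation rv :: "vname \<Rightarrow> rexp" where "rv x \<equiv> RGet x (NConst 0)"
abbreviation rset :: "vname \<Rightarrow> rexp \<Rightarrow> com" where "rset x e \<equiv> RSet x (NConst 0) e"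
abbreviation Or :: "bexp \<Rightarrow> bexp \<Rightarrow> bexp" where "Or b b' \<equiv> Neg (Conj (Neg b) (Neg b'))"

abbreviation key :: "vname \<Rightarrow> rexp" where
  "key x \<equiv> RDiv (RGet ''c'' (nv x)) (RGet ''v'' (nv x))"

text \<open>The negated comparison stands for equality of the ratios, as the strict case is the
  first disjunct.\<close>

definition count_before :: com where
  "count_before = Cond
    (Or (RLess (key ''k'') (key ''i''))
        (Conj (Neg (RLess (key ''i'') (key ''k''))) (NLess (nv ''k'') (nv ''i''))))
    (NSet ''r'' (NConst 0) (NAdd (nv ''r'') (NConst 1))) Skip"

text \<open>Sorting by counting predecessors, in quadratic time: \<open>perm\<close> becomes the
  inverse of \<open>rank\<close>. Cell \<open>M\<close> finally holds \<open>1 + M\<close>.\<close>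

definition rank_goods :: com where
  "rank_goods = Seq
    (For ''i'' (nv ''n'')
      (Seq (Seq (rset ''M'' (RAdd (rv ''M'') (RDiv (RConst 1) (RGet ''v'' (nv ''i'')))))
                (NSet ''r'' (NConst 0) (NConst 0)))
      (Seq (For ''k'' (nv ''n'') count_before)
           (NSet ''perm'' (nv ''r'') (nv ''i'')))))
    (Seq (rset ''M'' (RAdd (RConst 1) (rv ''M'')))
    (Seq (rset ''eta'' (RDiv (rv ''eps'')
           (RMul (rv ''M'') (RAdd (rv ''eps'') (RMul (rv ''M'') (rv ''M''))))))
         (rset ''g0'' (RSub (RConst 1) (RMul (rv ''eta'') (rv ''M''))))))"

abbreviation forced_test :: bexp where
  "forced_test \<equiv> Or (RLess (rv ''w'') (RGet ''v'' (nv ''i''))) (RLess (RGet ''c'' (nv ''i'')) (RConst 0))"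

text \<open>The quotient is overwritten by 1 whenever \<open>w < V i\<close>, in particular for
  \<open>w = 0\<close>, where it was a division by zero.\<close>

definition add_cap :: com where
  "add_cap = Seq
    (RSet ''a'' (nv ''i'') (RDiv (RGet ''v'' (nv ''i'')) (rv ''w'')))
    (Seq (Cond (RLess (rv ''w'') (RGet ''v'' (nv ''i''))) (RSet ''a'' (nv ''i'') (RConst 1)) Skip)
    (Cond forced_test (rset ''S'' (RAdd (rv ''S'') (RGet ''a'' (nv ''i'')))) Skip))"

text \<open>From here on cell \<open>S\<close>, the sum of the forced caps, is reused for the scaling factor.\<close>

definition set_scale :: com where
  "set_scale = Seq
    (Cond (RLess (rv ''B'') (rv ''S''))
      (rset ''S'' (RDiv (rv ''B'') (rv ''S''))) (rset ''S'' (RConst 1)))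
    (Seq (rset ''D'' (rv ''B'')) (rset ''val'' (RConst 0)))"

definition price_forced :: com where
  "price_forced = Cond forced_test
    (Seq (RSet ''q'' (nv ''i'') (RMul (RMul (rv ''S'') (rv ''g0'')) (RGet ''a'' (nv ''i''))))
    (Seq (rset ''D'' (RSub (rv ''D'') (RGet ''q'' (nv ''i''))))
         (rset ''val'' (RAdd (rv ''val'') (RSub (RGet ''q'' (nv ''i'')) (RGet ''c'' (nv ''i'')))))))
    Skip"

text \<open>\<open>k\<close> runs through the ranks. \<open>g\<close> grows for forced goods too,
  because ranks count all goods, and it grows before its use, which yields the \<open>Suc\<close> in
  \<open>price\<close>.\<close>

definition price_rest :: com where
  "price_rest = Seq (NSet ''i'' (NConst 0) (NGet ''perm'' (nv ''k'')))
    (Seq (rset ''g'' (RAdd (rv ''g'') (rv ''eta'')))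
    (Cond forced_test Skip
      (Seq (RSet ''q'' (nv ''i'') (RMul (RGet ''a'' (nv ''i'')) (rv ''g'')))
      (Seq (rset ''x'' (RConst 1))
      (Seq (Cond (RLess (rv ''D'') (RGet ''q'' (nv ''i'')))
             (rset ''x'' (RDiv (rv ''D'') (RGet ''q'' (nv ''i'')))) Skip)
      (Seq (Cond (RLess (rv ''D'') (RConst 0)) (rset ''x'' (RConst 0)) Skip)
      (Seq (rset ''D'' (RSub (rv ''D'') (RGet ''q'' (nv ''i''))))
           (rset ''val'' (RAdd (rv ''val'')
             (RMul (rv ''x'') (RSub (RGet ''q'' (nv ''i'')) (RGet ''c'' (nv ''i'')))))))))))))"

definition evaluate :: com where
  "evaluate = Seq (Seq (rset ''w'' (RGet ''v'' (nv ''j''))) (rset ''S'' (RConst 0)))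
    (Seq (For ''i'' (nv ''n'') add_cap)
    (Seq set_scale
    (Seq (For ''i'' (nv ''n'') price_forced)
    (Seq (rset ''g'' (rv ''g0''))
         (For ''k'' (nv ''n'') price_rest)))))"

text \<open>Round 0 always stores its prices, since gains can be negative and \<open>best\<close>
  has no meaning yet.\<close>

definition keep_best :: com where
  "keep_best = Cond (Or (Neg (NLess (NConst 0) (nv ''j''))) (RLess (rv ''best'') (rv ''val'')))
    (Seq (rset ''best'' (rv ''val''))
         (For ''i'' (nv ''n'') (RSet ''p'' (nv ''i'') (RGet ''q'' (nv ''i'')))))
    Skip"

definition opt_price :: com where
  "opt_price = Seq rank_goods
    (For ''j'' (NAdd (nv ''n'') (NConst 1)) (Seq evaluate keep_best))"

section \<open>Auxiliary counting and the asymptotic bound\<close>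

lemma sum_filter_Suc:
  fixes f :: "nat \<Rightarrow> real"
  shows "(\<Sum>i | i < Suc k \<and> Q i. f i) = (\<Sum>i | i < k \<and> Q i. f i) + (if Q k then f k else 0)"
proof -
  have "{i. i < Suc k \<and> Q i} = (if Q k then insert k {i. i < k \<and> Q i} else {i. i < k \<and> Q i})"
    by (auto simp: less_Suc_eq)
  then show ?thesis by auto
qed

lemma card_filter_Suc:
  "card {i. i < Suc k \<and> Q i} = card {i. i < k \<and> Q i} + (if Q k then 1 else 0)"
proof -
  have "{i. i < Suc k \<and> Q i} = (if Q k then insert k {i. i < k \<and> Q i} else {i. i < k \<and> Q i})"
    by (auto simp: less_Suc_eq)
  then show ?thesis by auto
qed

text \<open>Quadratic time suffices: \<open>ln n \<ge> 1\<close> from \<open>n = 3\<close> on, as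
  \<open>exp 1 \<le> 3\<close>, and \<open>(n + 1)^2 \<le> 4 * n^2\<close>.\<close>

lemma quadratic_bound: "(\<lambda>n. real (1000 * (n + 1)\<^sup>2)) \<in> O(\<lambda>n. (real n)\<^sup>2 * ln (real n))"
proof (rule bigoI[where c = 4000])
  have "norm (real (1000 * (n + 1)\<^sup>2)) \<le> 4000 * norm ((real n)\<^sup>2 * ln (real n))" if "n \<ge> 3" for n :: nat
  proof -
    have "1 \<le> ln (real n)"
    proof -
      have "exp 1 \<le> real n" using that exp_le by linarith
      then show ?thesis using that by (subst ln_ge_iff) auto
    qed
    then have "(real n)\<^sup>2 * 1 \<le> (real n)\<^sup>2 * ln (real n)" by (intro mult_left_mono) auto
    moreover have "(real n + 1)\<^sup>2 \<le> (2 * real n)\<^sup>2" using that by (intro power_mono) auto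
    ultimately have "1000 * (real n + 1)\<^sup>2 \<le> 4000 * ((real n)\<^sup>2 * ln (real n))"
      by (simp add: power_mult_distrib mult.commute)
    also have "\<dots> \<le> 4000 * norm ((real n)\<^sup>2 * ln (real n))" by simp
    finally show ?thesis by (simp add: add.commute)
  qed
  then show "\<forall>\<^sub>F n in at_top. norm (real (1000 * (n + 1)\<^sup>2)) \<le> 4000 * norm ((real n)\<^sup>2 * ln (real n))"
    using eventually_at_top_linorder by blast
qed

section \<open>Correctness and running time of the program\<close>

context pricing
begin

text \<open>Whole arrays are compared, not only their first \<open>n\<close> cells, because the last
  candidate is read from cell \<open>n\<close> of the valuations.\<close>

definition input_ok :: "state \<Rightarrow> bool" where
  "input_ok s \<longleftrightarrow> nats s ''n'' 0 = n \<and> reals s ''B'' 0 = B \<and> reals s ''eps'' 0 = \<epsilon> \<and>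
    reals s ''v'' = V \<and> reals s ''c'' = C"

definition ranked :: "state \<Rightarrow> bool" where
  "ranked s \<longleftrightarrow> input_ok s \<and> reals s ''eta'' 0 = eta \<and> reals s ''g0'' 0 = g0 \<and>
    (\<forall>i<n. nats s ''perm'' (rank i) = i)"

text \<open>\<open>m\<close> and \<open>f\<close> record what the inner loop leaves alone, for the
  invariant of the outer loop.\<close>

lemma run_count_before:
  assumes "input_ok s" "nats s ''i'' 0 = i" "reals s ''M'' 0 = m" "nats s ''perm'' = f" "nats s ''r'' 0 = 0"
  shows "run (For ''k'' (nv ''n'') count_before) s (8 + n * 120)
    (\<lambda>s. input_ok s \<and> nats s ''i'' 0 = i \<and> reals s ''M'' 0 = m \<and> nats s ''perm'' = f \<and>
      nats s ''r'' 0 = rank i)"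
proof -
  let ?I = "\<lambda>k s. input_ok s \<and> nats s ''i'' 0 = i \<and> reals s ''M'' 0 = m \<and> nats s ''perm'' = f \<and>
    nats s ''r'' 0 = card {k'. k' < k \<and> before k' i}"
  have "run (For ''k'' (nv ''n'') count_before) s (8 + n * 120) (?I n)"
  proof (rule run_For[where N = n and t = 100 and I = ?I])
    show "?I 0 (set_counter ''k'' 0 s)" using assms by (simp add: input_ok_def)
  next
    fix k s assume "k < n" and I: "?I k s" "nats s ''k'' 0 = k"
    show "run count_before s 100 (\<lambda>s'. nats s' ''k'' 0 = k \<and> ?I (Suc k) (set_counter ''k'' (Suc k) s'))"
    proof (rule run_loop_free)
      show "nats (step count_before s) ''k'' 0 = k \<and> ?I (Suc k) (set_counter ''k'' (Suc k) (step count_before s))"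
        using I by (auto simp: count_before_def input_ok_def card_filter_Suc before_def)
    qed (simp_all add: count_before_def)
  qed (auto simp: input_ok_def)
  then show ?thesis by (simp add: rank_def)
qed

lemma run_rank_goods:
  assumes "input_ok s" "reals s ''M'' 0 = 0"
  shows "run rank_goods s (100 + n * (100 + n * 120)) ranked"
proof -
  let ?I = "\<lambda>k s. input_ok s \<and> reals s ''M'' 0 = (\<Sum>i<k. 1 / V i) \<and> (\<forall>i<k. nats s ''perm'' (rank i) = i)"
  have "run (For ''i'' (nv ''n'')
      (Seq (Seq (rset ''M'' (RAdd (rv ''M'') (RDiv (RConst 1) (RGet ''v'' (nv ''i'')))))
                (NSet ''r'' (NConst 0) (NConst 0)))
      (Seq (For ''k'' (nv ''n'') count_before)
           (NSet ''perm'' (nv ''r'') (nv ''i''))))) s (8 + n * (100 + n * 120)) (?I n)"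
    (is "run (For _ _ (Seq ?init (Seq ?count ?store))) _ _ _")
  proof (rule run_For[where N = n and t = "80 + n * 120" and I = ?I])
    show "?I 0 (set_counter ''i'' 0 s)" using assms by (simp add: input_ok_def)
  next
    fix k s assume k: "k < n" and I: "?I k s" "nats s ''i'' 0 = k"
    let ?m = "\<Sum>i<Suc k. 1 / V i"
    show "run (Seq ?init (Seq ?count ?store)) s (80 + n * 120)
      (\<lambda>s'. nats s' ''i'' 0 = k \<and> ?I (Suc k) (set_counter ''i'' (Suc k) s'))"
    proof (rule run_Seq[where t = 15])
      let ?Q = "\<lambda>s'. input_ok s' \<and> nats s' ''i'' 0 = k \<and> reals s' ''M'' 0 = ?m \<and>
        nats s' ''perm'' = nats s ''perm'' \<and> nats s' ''r'' 0 = 0"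
      show "run ?init s 15 ?Q"
        using I by (intro run_loop_free) (auto simp: input_ok_def)
      fix s' assume "?Q s'"
      then have "run ?count s' (8 + n * 120) (\<lambda>s'. input_ok s' \<and> nats s' ''i'' 0 = k \<and> reals s' ''M'' 0 = ?m \<and>
        nats s' ''perm'' = nats s ''perm'' \<and> nats s' ''r'' 0 = rank k)"
        by (intro run_count_before) auto
      then show "run (Seq ?count ?store) s' (18 + n * 120)
        (\<lambda>s'. nats s' ''i'' 0 = k \<and> ?I (Suc k) (set_counter ''i'' (Suc k) s'))"
      proof (rule run_Seq[where u = 10])
        fix s' assume s': "input_ok s' \<and> nats s' ''i'' 0 = k \<and> reals s' ''M'' 0 = ?m \<and>
          nats s' ''perm'' = nats s ''perm'' \<and> nats s' ''r'' 0 = rank k"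
        \<comment> \<open>The new entry of \<open>perm\<close> overwrites no earlier one.\<close>
        have "rank i \<noteq> rank k" if "i < k" for i
          using rank_inj that k by (auto simp: inj_on_def)
        then show "run ?store s' 10 (\<lambda>s'. nats s' ''i'' 0 = k \<and> ?I (Suc k) (set_counter ''i'' (Suc k) s'))"
          using s' I by (intro run_loop_free) (auto simp: input_ok_def less_Suc_eq)
      qed simp
    qed simp
  qed (auto simp: input_ok_def)
  then show ?thesis
    unfolding rank_goods_def
  proof (rule run_Seq[where u = 50])
    fix s assume "?I n s"
    then show "run (Seq (rset ''M'' (RAdd (RConst 1) (rv ''M'')))
      (Seq (rset ''eta'' (RDiv (rv ''eps'')
           (RMul (rv ''M'') (RAdd (rv ''eps'') (RMul (rv ''M'') (rv ''M''))))))
         (rset ''g0'' (RSub (RConst 1) (RMul (rv ''eta'') (rv ''M'')))))) s 50 ranked"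
      by (intro run_loop_free) (auto simp: ranked_def input_ok_def M_def[symmetric] eta_def g0_def)
  qed simp
qed

text \<open>\<open>b\<close> and \<open>f\<close> freeze the best gain and prices stored so far,
  which the evaluation of a candidate must preserve.\<close>

definition candidate :: "nat \<Rightarrow> real \<Rightarrow> (nat \<Rightarrow> real) \<Rightarrow> state \<Rightarrow> bool" where
  "candidate j b f s \<longleftrightarrow> ranked s \<and> nats s ''j'' 0 = j \<and> reals s ''w'' 0 = V j \<and>
    reals s ''best'' 0 = b \<and> reals s ''p'' = f"

lemmas candidate_defs = candidate_def ranked_def input_ok_def

lemma run_add_cap:
  assumes "candidate j b f s" "reals s ''S'' 0 = 0"
  shows "run (For ''i'' (nv ''n'') add_cap) s (8 + n * 100)
    (\<lambda>s. candidate j b f s \<and> (\<forall>i<n. reals s ''a'' i = cap (V j) i) \<and> reals s ''S'' 0 = forced_cap (V j))"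
proof -
  let ?I = "\<lambda>k s. candidate j b f s \<and> (\<forall>i<k. reals s ''a'' i = cap (V j) i) \<and>
    reals s ''S'' 0 = (\<Sum>i | i < k \<and> forced (V j) i. cap (V j) i)"
  have "run (For ''i'' (nv ''n'') add_cap) s (8 + n * 100) (?I n)"
  proof (rule run_For[where N = n and t = 80 and I = ?I])
    show "?I 0 (set_counter ''i'' 0 s)" using assms by (simp add: candidate_defs)
  next
    fix k s assume "k < n" and I: "?I k s" "nats s ''i'' 0 = k"
    show "run add_cap s 80 (\<lambda>s'. nats s' ''i'' 0 = k \<and> ?I (Suc k) (set_counter ''i'' (Suc k) s'))"
    proof (rule run_loop_free)
      show "nats (step add_cap s) ''i'' 0 = k \<and> ?I (Suc k) (set_counter ''i'' (Suc k) (step add_cap s))"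
        using I by (simp add: add_cap_def candidate_defs sum_filter_Suc forced_def cap_def All_less_Suc)
    qed (simp_all add: add_cap_def)
  qed (auto simp: candidate_defs)
  then show ?thesis by (simp add: forced_cap_def)
qed

lemma run_price_forced:
  assumes "candidate j b f s" "\<forall>i<n. reals s ''a'' i = cap (V j) i" "reals s ''S'' 0 = scale (V j)"
    "reals s ''D'' 0 = B" "reals s ''val'' 0 = 0"
  shows "run (For ''i'' (nv ''n'') price_forced) s (8 + n * 100)
    (\<lambda>s. candidate j b f s \<and> (\<forall>i<n. reals s ''a'' i = cap (V j) i) \<and>
      reals s ''D'' 0 = budget_left (V j) 0 \<and>
      reals s ''val'' 0 = (\<Sum>i\<in>early (V j) 0. share (V j) i * (price (V j) i - C i)) \<and>
      (\<forall>i\<in>early (V j) 0. reals s ''q'' i = price (V j) i))"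
proof -
  let ?I = "\<lambda>k s. candidate j b f s \<and> (\<forall>i<n. reals s ''a'' i = cap (V j) i) \<and>
      reals s ''S'' 0 = scale (V j) \<and>
      reals s ''D'' 0 = B - (\<Sum>i | i < k \<and> forced (V j) i. price (V j) i) \<and>
      reals s ''val'' 0 = (\<Sum>i | i < k \<and> forced (V j) i. price (V j) i - C i) \<and>
      (\<forall>i<k. forced (V j) i \<longrightarrow> reals s ''q'' i = price (V j) i)"
  have "run (For ''i'' (nv ''n'') price_forced) s (8 + n * 100) (?I n)"
  proof (rule run_For[where N = n and t = 80 and I = ?I])
    show "?I 0 (set_counter ''i'' 0 s)" using assms by (simp add: candidate_defs)
  next
    fix k s assume k: "k < n" and I: "?I k s" "nats s ''i'' 0 = k"
    have p: "price (V j) k = scale (V j) * g0 * cap (V j) k" if "forced (V j) k"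
      using that by (simp add: price_def)
    show "run price_forced s 80 (\<lambda>s'. nats s' ''i'' 0 = k \<and> ?I (Suc k) (set_counter ''i'' (Suc k) s'))"
    proof (rule run_loop_free)
      show "nats (step price_forced s) ''i'' 0 = k \<and> ?I (Suc k) (set_counter ''i'' (Suc k) (step price_forced s))"
      proof (cases "forced (V j) k")
        case True
        then have "bval forced_test s" using I by (auto simp: forced_def candidate_defs)
        then show ?thesis
          using I k True p[OF True] by (auto simp: price_forced_def candidate_defs sum_filter_Suc All_less_Suc)
      next
        case False
        then have "\<not> bval forced_test s" using I by (auto simp: forced_def candidate_defs)
        then show ?thesis
          using I k False by (auto simp: price_forced_def candidate_defs sum_filter_Suc All_less_Suc)
      qed
    qed (simp_all add: price_forced_def)
  qed (auto simp: candidate_defs)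
  moreover have "(\<Sum>i\<in>early (V j) 0. share (V j) i * (price (V j) i - C i)) =
      (\<Sum>i | i < n \<and> forced (V j) i. price (V j) i - C i)"
    by (rule sum.cong) (auto simp: early_def share_def)
  ultimately show ?thesis
    by (elim run_mono) (auto simp: budget_left_def early_def)
qed

text \<open>The invariant is phrased through \<open>early (V j) k\<close>, so a round is an
  application of \<open>early_Suc\<close>, and \<open>early_n\<close> turns the accumulated sum into
  the gain.\<close>

lemma run_price_rest:
  assumes "candidate j b f s" "\<forall>i<n. reals s ''a'' i = cap (V j) i" "reals s ''g'' 0 = g0"
      "reals s ''D'' 0 = budget_left (V j) 0"
      "reals s ''val'' 0 = (\<Sum>i\<in>early (V j) 0. share (V j) i * (price (V j) i - C i))"
      "\<forall>i\<in>early (V j) 0. reals s ''q'' i = price (V j) i"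
    and w: "V j = 0 \<or> (\<exists>l<n. V j = V l)"
  shows "run (For ''k'' (nv ''n'') price_rest) s (8 + n * 140)
    (\<lambda>s. candidate j b f s \<and> reals s ''val'' 0 = gain (V j) \<and> (\<forall>i<n. reals s ''q'' i = price (V j) i))"
proof -
  let ?I = "\<lambda>k s. candidate j b f s \<and> (\<forall>i<n. reals s ''a'' i = cap (V j) i) \<and>
      reals s ''g'' 0 = g0 + eta * real k \<and>
      reals s ''D'' 0 = budget_left (V j) k \<and>
      reals s ''val'' 0 = (\<Sum>i\<in>early (V j) k. share (V j) i * (price (V j) i - C i)) \<and>
      (\<forall>i\<in>early (V j) k. reals s ''q'' i = price (V j) i)"
  have "run (For ''k'' (nv ''n'') price_rest) s (8 + n * 140) (?I n)"
  proof (rule run_For[where N = n and t = 120 and I = ?I])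
    show "?I 0 (set_counter ''k'' 0 s)" using assms by (simp add: candidate_defs)
  next
    fix k s assume k: "k < n" and I: "?I k s" "nats s ''k'' 0 = k"
    obtain i where i: "i < n" "rank i = k" using rank_surj[OF k] by blast
    have perm: "nats s ''perm'' k = i" using I i by (auto simp: candidate_defs)
    note early_Suc = early_Suc[OF w i] and [simp] = finite_early[OF w]
    have g: "g0 + eta * real k + eta = g0 + eta * real (Suc k)" by (simp add: algebra_simps)
    show "run price_rest s 120 (\<lambda>s'. nats s' ''k'' 0 = k \<and> ?I (Suc k) (set_counter ''k'' (Suc k) s'))"
    proof (rule run_loop_free)
      show "nats (step price_rest s) ''k'' 0 = k \<and> ?I (Suc k) (set_counter ''k'' (Suc k) (step price_rest s))"
      proof (cases "forced (V j) i")
        case True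
        then have e: "early (V j) (Suc k) = early (V j) k" using early_Suc by auto
        have "V j < V i \<or> C i < 0" using True by (simp add: forced_def)
        then show ?thesis
          using I perm True by (auto simp: price_rest_def candidate_defs e budget_left_def algebra_simps)
      next
        case False
        then have ni: "i \<notin> early (V j) k" using early_Suc(2) by simp
        have t: "\<not> V j < V i" "\<not> C i < 0" using False by (auto simp: forced_def)
        have p: "cap (V j) i * (g0 + eta * (1 + real k)) = price (V j) i"
          using False i by (simp add: price_def algebra_simps)
        have D: "budget_left (V j) (Suc k) = budget_left (V j) k - price (V j) i"
          using ni by (simp add: budget_left_def early_Suc(1))
        have x: "share (V j) i = (if budget_left (V j) k < 0 then 0
          else if budget_left (V j) k < price (V j) i then budget_left (V j) k / price (V j) i else 1)"
          using False i by (simp add: share_def)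
        have a: "reals s ''a'' i = cap (V j) i" using I i by simp
        show ?thesis
          using I perm t ni a unfolding early_Suc(1) D candidate_defs
          by (simp add: price_rest_def p x g)
      qed
    qed (simp_all add: price_rest_def)
  qed (auto simp: candidate_defs)
  then show ?thesis
    by (rule run_mono) (auto simp: early_n[OF w] gain_def)
qed

lemma run_evaluate:
  assumes "ranked s" "nats s ''j'' 0 = j" "reals s ''best'' 0 = b" "reals s ''p'' = f"
    and w: "V j = 0 \<or> (\<exists>l<n. V j = V l)"
  shows "run evaluate s (80 + n * 340)
    (\<lambda>s. candidate j b f s \<and> reals s ''val'' 0 = gain (V j) \<and> (\<forall>i<n. reals s ''q'' i = price (V j) i))"
  unfolding evaluate_def
proof (rule run_Seq[where t = 10])
  let ?Q = "\<lambda>s. candidate j b f s \<and> reals s ''S'' 0 = 0"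
  show "run (Seq (rset ''w'' (RGet ''v'' (nv ''j''))) (rset ''S'' (RConst 0))) s 10 ?Q"
    using assms by (intro run_loop_free) (auto simp: candidate_defs)
  fix s assume "?Q s"
  then have "run (For ''i'' (nv ''n'') add_cap) s (8 + n * 100) (\<lambda>s. candidate j b f s \<and>
      (\<forall>i<n. reals s ''a'' i = cap (V j) i) \<and> reals s ''S'' 0 = forced_cap (V j))"
    by (intro run_add_cap) auto
  then show "run (Seq (For ''i'' (nv ''n'') add_cap) (Seq set_scale (Seq (For ''i'' (nv ''n'') price_forced)
      (Seq (rset ''g'' (rv ''g0'')) (For ''k'' (nv ''n'') price_rest))))) s (70 + n * 340)
    (\<lambda>s. candidate j b f s \<and> reals s ''val'' 0 = gain (V j) \<and> (\<forall>i<n. reals s ''q'' i = price (V j) i))"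
  proof (rule run_Seq[where u = "62 + n * 240"])
    fix s assume s: "candidate j b f s \<and> (\<forall>i<n. reals s ''a'' i = cap (V j) i) \<and>
      reals s ''S'' 0 = forced_cap (V j)"
    let ?Q = "\<lambda>s. candidate j b f s \<and> (\<forall>i<n. reals s ''a'' i = cap (V j) i) \<and>
      reals s ''S'' 0 = scale (V j) \<and> reals s ''D'' 0 = B \<and> reals s ''val'' 0 = 0"
    show "run (Seq set_scale (Seq (For ''i'' (nv ''n'') price_forced)
      (Seq (rset ''g'' (rv ''g0'')) (For ''k'' (nv ''n'') price_rest)))) s (62 + n * 240)
    (\<lambda>s. candidate j b f s \<and> reals s ''val'' 0 = gain (V j) \<and> (\<forall>i<n. reals s ''q'' i = price (V j) i))"
    proof (rule run_Seq[where t = 40 and u = "22 + n * 240"])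
      show "run set_scale s 40 ?Q"
        using s by (intro run_loop_free) (auto simp: candidate_defs set_scale_def scale_def)
      fix s assume "?Q s"
      then have "run (For ''i'' (nv ''n'') price_forced) s (8 + n * 100)
        (\<lambda>s. candidate j b f s \<and> (\<forall>i<n. reals s ''a'' i = cap (V j) i) \<and>
          reals s ''D'' 0 = budget_left (V j) 0 \<and>
          reals s ''val'' 0 = (\<Sum>i\<in>early (V j) 0. share (V j) i * (price (V j) i - C i)) \<and>
          (\<forall>i\<in>early (V j) 0. reals s ''q'' i = price (V j) i))"
        by (intro run_price_forced) auto
      then show "run (Seq (For ''i'' (nv ''n'') price_forced)
        (Seq (rset ''g'' (rv ''g0'')) (For ''k'' (nv ''n'') price_rest))) s (22 + n * 240)
        (\<lambda>s. candidate j b f s \<and> reals s ''val'' 0 = gain (V j) \<and> (\<forall>i<n. reals s ''q'' i = price (V j) i))"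
      proof (rule run_Seq[where u = "14 + n * 140"])
        fix s assume s: "candidate j b f s \<and> (\<forall>i<n. reals s ''a'' i = cap (V j) i) \<and>
          reals s ''D'' 0 = budget_left (V j) 0 \<and>
          reals s ''val'' 0 = (\<Sum>i\<in>early (V j) 0. share (V j) i * (price (V j) i - C i)) \<and>
          (\<forall>i\<in>early (V j) 0. reals s ''q'' i = price (V j) i)"
        have "run (rset ''g'' (rv ''g0'')) s 6 (\<lambda>s. candidate j b f s \<and> (\<forall>i<n. reals s ''a'' i = cap (V j) i) \<and>
          reals s ''g'' 0 = g0 \<and> reals s ''D'' 0 = budget_left (V j) 0 \<and>
          reals s ''val'' 0 = (\<Sum>i\<in>early (V j) 0. share (V j) i * (price (V j) i - C i)) \<and>
          (\<forall>i\<in>early (V j) 0. reals s ''q'' i = price (V j) i))"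
          using s by (intro run_loop_free) (auto simp: candidate_defs)
        then show "run (Seq (rset ''g'' (rv ''g0'')) (For ''k'' (nv ''n'') price_rest)) s (14 + n * 140)
        (\<lambda>s. candidate j b f s \<and> reals s ''val'' 0 = gain (V j) \<and> (\<forall>i<n. reals s ''q'' i = price (V j) i))"
          by (rule run_Seq[where u = "8 + n * 140"]) (auto intro!: run_price_rest w)
      qed simp
    qed simp
  qed simp
qed simp

text \<open>Nothing is claimed about \<open>p\<close> and \<open>best\<close> before the first
  round.\<close>

definition best_so_far :: "nat \<Rightarrow> state \<Rightarrow> bool" where
  "best_so_far k s \<longleftrightarrow> ranked s \<and> (0 < k \<longrightarrow>
    (\<exists>l\<le>n. (\<forall>i<n. reals s ''p'' i = price (V l) i) \<and> reals s ''best'' 0 = gain (V l) \<and>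
      (\<forall>l'<k. gain (V l') \<le> reals s ''best'' 0)))"

lemma run_keep_best:
  assumes s: "candidate k b f s" "reals s ''val'' 0 = gain (V k)" "\<forall>i<n. reals s ''q'' i = price (V k) i"
    and k: "k \<le> n"
    and prev: "0 < k \<Longrightarrow> \<exists>l\<le>n. (\<forall>i<n. f i = price (V l) i) \<and> b = gain (V l) \<and> (\<forall>l'<k. gain (V l') \<le> b)"
  shows "run keep_best s (60 + n * 40)
    (\<lambda>s'. nats s' ''j'' 0 = k \<and> best_so_far (Suc k) (set_counter ''j'' (Suc k) s'))"
  unfolding keep_best_def
proof (rule run_Cond[where t = "20 + n * 40"])
  let ?b = "Or (Neg (NLess (NConst 0) (nv ''j''))) (RLess (rv ''best'') (rv ''val''))"
  let ?copy = "For ''i'' (nv ''n'') (RSet ''p'' (nv ''i'') (RGet ''q'' (nv ''i'')))"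
  assume "bval ?b s"
  then have "k = 0 \<or> b < gain (V k)" using s by (auto simp: candidate_defs)
  then have best: "gain (V l') \<le> gain (V k)" if "l' < Suc k" for l'
    using prev that by (cases "l' = k") (force simp: less_Suc_eq)+
  let ?Q = "\<lambda>s. ranked s \<and> nats s ''j'' 0 = k \<and> reals s ''best'' 0 = gain (V k) \<and>
    (\<forall>i<n. reals s ''q'' i = price (V k) i)"
  let ?I = "\<lambda>m s. ?Q s \<and> (\<forall>i<m. reals s ''p'' i = price (V k) i)"
  show "run (Seq (rset ''best'' (rv ''val'')) ?copy) s (20 + n * 40)
    (\<lambda>s'. nats s' ''j'' 0 = k \<and> best_so_far (Suc k) (set_counter ''j'' (Suc k) s'))"
  proof (rule run_Seq[where t = 10 and u = "10 + n * 40"])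
    show "run (rset ''best'' (rv ''val'')) s 10 ?Q"
      using s by (intro run_loop_free) (auto simp: candidate_defs)
    fix s assume Q: "?Q s"
    have "run ?copy s (10 + n * 40) (?I n)"
    proof (rule run_For[where N = n and t = 20 and I = ?I])
      show "?I 0 (set_counter ''i'' 0 s)" using Q by (simp add: candidate_defs)
    next
      fix m s assume "m < n" "?I m s" "nats s ''i'' 0 = m"
      then show "run (RSet ''p'' (nv ''i'') (RGet ''q'' (nv ''i''))) s 20
          (\<lambda>s'. nats s' ''i'' 0 = m \<and> ?I (Suc m) (set_counter ''i'' (Suc m) s'))"
        by (intro run_loop_free) (auto simp: candidate_defs less_Suc_eq)
    qed (auto simp: candidate_defs)
    then show "run ?copy s (10 + n * 40)
      (\<lambda>s'. nats s' ''j'' 0 = k \<and> best_so_far (Suc k) (set_counter ''j'' (Suc k) s'))"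
      by (rule run_mono) (use k best in \<open>auto simp: best_so_far_def candidate_defs\<close>)
  qed simp
next
  assume "\<not> bval (Or (Neg (NLess (NConst 0) (nv ''j''))) (RLess (rv ''best'') (rv ''val''))) s"
  then have "0 < k" "gain (V k) \<le> b" using s by (auto simp: candidate_defs)
  then obtain l where "l \<le> n" "\<forall>i<n. f i = price (V l) i" "b = gain (V l)" "\<forall>l'<Suc k. gain (V l') \<le> b"
    using prev less_Suc_eq by auto
  then have "best_so_far (Suc k) (set_counter ''j'' (Suc k) s)"
    unfolding best_so_far_def using s by (intro conjI impI exI[of _ l]) (auto simp: candidate_defs)
  then show "run Skip s (20 + n * 40)
    (\<lambda>s'. nats s' ''j'' 0 = k \<and> best_so_far (Suc k) (set_counter ''j'' (Suc k) s'))"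
    using s by (intro run_loop_free) (auto simp: candidate_defs)
qed simp

lemma run_opt_price:
  assumes "input_ok s" "reals s ''M'' 0 = 0"
  shows "run opt_price s (1000 * (n + 1)\<^sup>2) (\<lambda>s. \<exists>l\<le>n. (\<forall>i<n. reals s ''p'' i = price (V l) i) \<and>
    (\<forall>l'\<le>n. gain (V l') \<le> gain (V l)))"
proof -
  have "run opt_price s (1000 * (n + 1)\<^sup>2) (best_so_far (Suc n))"
    unfolding opt_price_def
  \<comment> \<open>Ranking and the \<open>n + 1\<close> rounds together take at most
    \<open>500 * n^2 + 640 * n + 270\<close> steps.\<close>
  proof (rule run_Seq[OF run_rank_goods[OF assms], where u = "10 + Suc n * (160 + n * 380)"])
    fix s assume s: "ranked s"
    show "run (For ''j'' (NAdd (nv ''n'') (NConst 1)) (Seq evaluate keep_best)) s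
      (10 + Suc n * (160 + n * 380)) (best_so_far (Suc n))"
    proof (rule run_For[where t = "140 + n * 380"])
      show "best_so_far 0 (set_counter ''j'' 0 s)"
        using s by (simp add: best_so_far_def candidate_defs)
    next
      fix k s assume k: "k < Suc n" and s: "best_so_far k s" "nats s ''j'' 0 = k"
      have w: "V k = 0 \<or> (\<exists>l<n. V k = V l)" using k V_n by (auto simp: less_Suc_eq)
      have "run evaluate s (80 + n * 340) (\<lambda>s'. candidate k (reals s ''best'' 0) (reals s ''p'') s' \<and>
          reals s' ''val'' 0 = gain (V k) \<and> (\<forall>i<n. reals s' ''q'' i = price (V k) i))"
        using s w by (intro run_evaluate) (auto simp: best_so_far_def)
      then show "run (Seq evaluate keep_best) s (140 + n * 380)
        (\<lambda>s'. nats s' ''j'' 0 = k \<and> best_so_far (Suc k) (set_counter ''j'' (Suc k) s'))"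
      proof (rule run_Seq)
        fix s' assume "candidate k (reals s ''best'' 0) (reals s ''p'') s' \<and>
          reals s' ''val'' 0 = gain (V k) \<and> (\<forall>i<n. reals s' ''q'' i = price (V k) i)"
        then show "run keep_best s' (60 + n * 40)
          (\<lambda>s'. nats s' ''j'' 0 = k \<and> best_so_far (Suc k) (set_counter ''j'' (Suc k) s'))"
          using k s(1) by (intro run_keep_best[where b = "reals s ''best'' 0" and f = "reals s ''p''"])
            (auto simp: best_so_far_def)
      qed simp
    qed (auto simp: best_so_far_def candidate_defs algebra_simps)
  qed (simp add: power2_eq_square algebra_simps)
  then show ?thesis
    by (rule run_mono) (auto simp: best_so_far_def less_Suc_eq_le)
qed



section \<open>Transfer to vectors and the final theorem\<close>

lemma demand_price:
  assumes v: "v \<in> carrier_vec n" "\<And>i. i < n \<Longrightarrow> v $ i = V i" and c: "c \<in> carrier_vec n" "\<And>i. i < n \<Longrightarrow> c $ i = C i"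
    and p: "p \<in> carrier_vec n" "\<And>i. i < n \<Longrightarrow> p $ i = price w i"
    and w: "w = 0 \<or> (\<exists>j<n. w = V j)"
  shows "p \<in> unit_cube n" and "demand n (utility v) p B = {vec n (share w)}"
    and "profit c p (vec n (share w)) = gain w"
proof -
  have sc: "\<And>x. x \<bullet> p = (\<Sum>i<n. x $ i * price w i)" "\<And>x. x \<bullet> v = (\<Sum>i<n. x $ i * V i)"
    using p v by (simp_all add: scalar_prod_sum[where n = n])
  show "p \<in> unit_cube n"
    using p price_nonneg[OF w] order_trans[OF price_le_cap[OF w] cap_le[OF w]] by (auto simp: unit_cube_def)
  have x: "vec n (share w) \<in> unit_cube n" using share_bounds[OF w] by (auto simp: unit_cube_def)
  have xB: "(\<Sum>i<n. share w i * price w i) \<le> B" using spent[OF w] by simp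
  have best: "(\<Sum>i<n. y $ i * V i) \<le> (\<Sum>i<n. share w i * V i)"
    and unique: "(\<Sum>i<n. share w i * V i) \<le> (\<Sum>i<n. y $ i * V i) \<Longrightarrow> y = vec n (share w)"
    if y: "y \<in> unit_cube n" "(\<Sum>i<n. y $ i * price w i) \<le> B" for y
  proof -
    have b: "\<And>i. i < n \<Longrightarrow> 0 \<le> y $ i \<and> y $ i \<le> 1" and d: "dim_vec y = n"
      using y(1) by (auto simp: unit_cube_def)
    show "(\<Sum>i<n. y $ i * V i) \<le> (\<Sum>i<n. share w i * V i)"
      by (rule share_is_optimal(1)[OF w]) (use b y(2) in auto)
    assume le: "(\<Sum>i<n. share w i * V i) \<le> (\<Sum>i<n. y $ i * V i)"
    have "y $ i = share w i" if "i < n" for i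
      by (rule share_is_optimal(2)[OF w _ y(2) le that]) (use b in auto)
    then show "y = vec n (share w)" using d by (intro eq_vecI) auto
  qed
  show "demand n (utility v) p B = {vec n (share w)}"
  proof (rule Set.set_eqI)
    fix z
    show "z \<in> demand n (utility v) p B \<longleftrightarrow> z \<in> {vec n (share w)}"
    proof
      assume "z \<in> demand n (utility v) p B"
      then have z: "z \<in> unit_cube n" "(\<Sum>i<n. z $ i * price w i) \<le> B"
        and "utility v (vec n (share w)) \<le> utility v z"
        using x xB by (simp_all add: demand_iff sc)
      then show "z \<in> {vec n (share w)}" using unique[OF z] by (simp add: utility_def sc)
    next
      assume "z \<in> {vec n (share w)}"
      then show "z \<in> demand n (utility v) p B"
        using x xB best by (simp add: demand_iff utility_def sc)
    qed
  qed
  show "profit c p (vec n (share w)) = gain w"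
    using p c by (simp add: profit_sum gain_def)
qed

text \<open>The supremum is attained, so \<open>gain_near_optimal\<close> has to be applied to one
  optimal pair of prices and bundle only.\<close>

lemma opt_profit_le_gain:
  assumes v: "v \<in> carrier_vec n" "\<And>i. i < n \<Longrightarrow> v $ i = V i" and c: "c \<in> carrier_vec n" "\<And>i. i < n \<Longrightarrow> c $ i = C i"
  shows "\<exists>j\<le>n. opt_profit n (utility v) c B - \<epsilon> \<le> gain (V j)"
proof -
  have "\<forall>i<n. 0 < v $ i" using v V_pos by simp
  from opt_profit_attained(1)[OF B_nonneg v(1) this c(1)]
  obtain p x where p: "p \<in> unit_cube n" and x: "x \<in> demand n (utility v) p B"
    and opt: "opt_profit n (utility v) c B = profit c p x" by blast
  have pc: "p \<in> carrier_vec n" using p by (simp add: unit_cube_def)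
  have sp: "y \<bullet> p = (\<Sum>i<n. y $ i * p $ i)" for y using pc by (rule scalar_prod_sum)
  have sv: "y \<bullet> v = (\<Sum>i<n. y $ i * V i)" for y using v by (simp add: scalar_prod_sum)
  have "\<exists>j\<le>n. (\<Sum>i<n. x $ i * (p $ i - C i)) - \<epsilon> \<le> gain (V j)"
  proof (rule gain_near_optimal)
    fix Y :: "nat \<Rightarrow> real"
    assume "\<And>i. i < n \<Longrightarrow> 0 \<le> Y i \<and> Y i \<le> 1" and YB: "(\<Sum>i<n. Y i * p $ i) \<le> B"
    then have "vec n Y \<in> unit_cube n" by (auto simp: unit_cube_def)
    moreover have "vec n Y \<bullet> p \<le> B" using YB by (simp add: sp)
    ultimately have "utility v (vec n Y) \<le> utility v x" using x by (auto simp: demand_iff)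
    then show "(\<Sum>i<n. Y i * V i) \<le> (\<Sum>i<n. x $ i * V i)" by (simp add: utility_def sv)
  qed (use p x in \<open>auto simp: demand_iff unit_cube_def sp\<close>)
  then show ?thesis unfolding opt using c by (simp add: profit_sum)
qed

end

theorem theorem1:
  shows "\<exists>(OptPrice :: com) (T :: nat \<Rightarrow> nat).
    (\<lambda>n. real (T n)) \<in> O(\<lambda>n. (real n)\<^sup>2 * ln (real n)) \<and>
    (\<forall>(n :: nat) (B :: real) (\<delta> :: real) (v :: real vec) (c :: real vec) (\<epsilon> :: real).
      0 \<le> B \<and> 0 < \<delta> \<and> 1 \<in> valuation_grid \<delta> \<and>
      v \<in> carrier_vec n \<and> (\<forall>i<n. v $ i \<in> valuation_grid \<delta>) \<and>
      c \<in> carrier_vec n \<and> (\<forall>i<n. c $ i \<le> 1) \<and> 0 < \<epsilon> \<longrightarrow>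
      (\<exists>t s. exec OptPrice (input_state n B v c \<epsilon>) t s \<and> t \<le> T n \<and>
        (let p_hat = output_prices n s in
          p_hat \<in> unit_cube n \<and>
          (\<exists>x_hat. demand n (utility v) p_hat B = {x_hat} \<and>
            profit c p_hat x_hat \<ge> opt_profit n (utility v) c B - \<epsilon>))))"
proof (rule exI[of _ opt_price], rule exI[of _ "\<lambda>n. 1000 * (n + 1)\<^sup>2"], intro conjI allI impI)
  show "(\<lambda>n. real (1000 * (n + 1)\<^sup>2)) \<in> O(\<lambda>n. (real n)\<^sup>2 * ln (real n))" by (rule quadratic_bound)
next
  fix n :: nat and B \<delta> :: real and v c :: "real vec" and \<epsilon> :: real
  assume a: "0 \<le> B \<and> 0 < \<delta> \<and> 1 \<in> valuation_grid \<delta> \<and>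
      v \<in> carrier_vec n \<and> (\<forall>i<n. v $ i \<in> valuation_grid \<delta>) \<and>
      c \<in> carrier_vec n \<and> (\<forall>i<n. c $ i \<le> 1) \<and> 0 < \<epsilon>"
  then have v: "v \<in> carrier_vec n" and c: "c \<in> carrier_vec n" by auto
  \<comment> \<open>Padding by 0 as in \<open>input_state\<close> gives \<open>V n = 0\<close>; the
    grid gives \<open>0 < V i \<le> 1\<close> for \<open>i < n\<close>.\<close>
  define V where "V = (\<lambda>i. if i < n then v $ i else 0)"
  define C where "C = (\<lambda>i. if i < n then c $ i else 0)"
  interpret pricing n B V C \<epsilon>
    using a by unfold_locales (auto simp: V_def C_def valuation_grid_def)
  have "input_ok (input_state n B v c \<epsilon>)" "reals (input_state n B v c \<epsilon>) ''M'' 0 = 0"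
    unfolding input_ok_def unfolding input_state_def V_def C_def by simp_all
  from run_opt_price[OF this] obtain t s l where
    exec: "exec opt_price (input_state n B v c \<epsilon>) t s" "t \<le> 1000 * (n + 1)\<^sup>2"
    and l: "l \<le> n" "\<forall>i<n. reals s ''p'' i = price (V l) i" "\<forall>l'\<le>n. gain (V l') \<le> gain (V l)"
    by (auto simp: run_def)
  have w: "V l = 0 \<or> (\<exists>j<n. V l = V j)" using l(1) V_n le_neq_implies_less by blast
  have p: "output_prices n s \<in> carrier_vec n" "\<And>i. i < n \<Longrightarrow> output_prices n s $ i = price (V l) i"
    using l(2) by (auto simp: output_prices_def)
  have vi: "\<And>i. i < n \<Longrightarrow> v $ i = V i" and ci: "\<And>i. i < n \<Longrightarrow> c $ i = C i" by (auto simp: V_def C_def)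
  obtain j where "j \<le> n" "opt_profit n (utility v) c B - \<epsilon> \<le> gain (V j)"
    using opt_profit_le_gain[OF v vi c ci] by blast
  then have "opt_profit n (utility v) c B - \<epsilon> \<le> gain (V l)" using l(3) by fastforce
  then show "\<exists>t s. exec opt_price (input_state n B v c \<epsilon>) t s \<and> t \<le> 1000 * (n + 1)\<^sup>2 \<and>
        (let p_hat = output_prices n s in
          p_hat \<in> unit_cube n \<and>
          (\<exists>x_hat. demand n (utility v) p_hat B = {x_hat} \<and>
            profit c p_hat x_hat \<ge> opt_profit n (utility v) c B - \<epsilon>))"
    using exec demand_price[OF v vi c ci p w] unfolding Let_def
    by (intro exI[of _ t] exI[of _ s] exI[of _ "vec n (share (V l))"] conjI) auto
qed

end
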